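(* Let $(\Omega,\mathcal F,(\mathcal F_t)_{t\in\mathbb R_+})$ be a filtered space with right-continuous filtration and $\mathcal F=\bigvee_t\mathcal F_t$, let $\mu$ and $\nu$ be probability measures on it, and let a nondecreasing sequence $\{V_n\}$ of stopping times be such that $\lim_nV_n=\infty$. If $T$ is a stopping time, then $$\|(\mu_T)_a\|=\liminf_{n\to\infty,\ \alpha\to1-0}H(\alpha;\mu_{T\wedge V_n},\nu_{T\wedge V_n})\quad\text{and}\quad\frac{d(\mu_T)_a}{d\nu_T}=\lim_{n\to\infty}\frac{d(\mu_{T\wedge V_n})_a}{d\nu_{T\wedge V_n}},\quad\nu_T\text{-a.s.},$$ where $(\mu_T)_a$ is the absolutely continuous part of $\mu_T$ with respect to $\nu_T$ (and $(\mu_{T\wedge V_n})_a$ that of $\mu_{T\wedge V_n}$ with respect to $\nu_{T\wedge V_n}$).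
   Context: Stopping times take values in $[0,\infty]$. For a stopping time $V$, $\mu_V,\nu_V$ are the restrictions of $\mu,\nu$ to $\mathcal F_V$. For finite measures $\rho,\sigma$ on the same space, $H(\alpha;\rho,\sigma)=\int\big(\frac{d\rho}{d\sigma}\big)^{\alpha}d\sigma$, where $\frac{d\rho}{d\sigma}$ is the density of the absolutely continuous part of $\rho$ with respect to $\sigma$. $\|\cdot\|$ is the total variation norm. The double lower limit is defined by $$\liminf_{n\to\infty,\ \alpha\to1-0}f(\alpha,n)=\sup_{n\in\mathbb N,\ \beta\in(0,1)}\ \inf_{m\ge n,\ x\in[\beta,1)}f(x,m).$$ *)

theory Defs
  imports "HOL-Probability.Probability"
begin

text \<open>
  A filtration \<open>(\<F>\<^sub>t)\<close>, \<open>t \<in> \<real>\<^sub>+\<close>, on a space with \<sigma>-algebra \<open>\<F>\<close> is encoded as a family indexed by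
  \<open>ennreal\<close>, whose value at \<open>\<infinity>\<close> is \<open>\<F>\<close>. The library's \<open>stopping_time\<close> and \<open>filtration.pre_sigma\<close>
  then give the usual notions for times with values in \<open>[0,\<infinity>]\<close>: the condition at \<open>t = \<infinity>\<close> is trivial
  for a stopping time, and says \<open>A \<in> \<F>\<close> for a member \<open>A\<close> of \<open>\<F>\<^sub>V\<close>.
\<close>

definition right_continuous_filtration :: "(ennreal \<Rightarrow> 'a measure) \<Rightarrow> bool" where
  "right_continuous_filtration F \<longleftrightarrow>
     (\<forall>t<\<infinity>. sets (F t) = (\<Inter>s\<in>{t<..<\<infinity>}. sets (F s)))"

definition restr_stop ::
  "'a set \<Rightarrow> (ennreal \<Rightarrow> 'a measure) \<Rightarrow> 'a measure \<Rightarrow> ('a \<Rightarrow> ennreal) \<Rightarrow> 'a measure" where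
  "restr_stop \<Omega> F M V = restr_to_subalg M (filtration.pre_sigma \<Omega> F V)"

definition mutually_singular :: "'a measure \<Rightarrow> 'a measure \<Rightarrow> bool" where
  "mutually_singular \<rho> \<sigma> \<longleftrightarrow> (\<exists>N\<in>sets \<sigma>. emeasure \<sigma> N = 0 \<and> emeasure \<rho> (space \<sigma> - N) = 0)"

definition lebesgue_decomposition ::
  "'a measure \<Rightarrow> 'a measure \<Rightarrow> 'a measure \<Rightarrow> 'a measure \<Rightarrow> bool" where
  "lebesgue_decomposition \<rho> \<sigma> \<rho>a \<rho>s \<longleftrightarrow>
     sets \<rho>a = sets \<rho> \<and> sets \<rho>s = sets \<rho> \<and>
     (\<forall>A\<in>sets \<rho>. emeasure \<rho> A = emeasure \<rho>a A + emeasure \<rho>s A) \<and>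
     absolutely_continuous \<sigma> \<rho>a \<and> mutually_singular \<rho>s \<sigma>"

definition ac_part :: "'a measure \<Rightarrow> 'a measure \<Rightarrow> 'a measure" where
  "ac_part \<rho> \<sigma> = (THE \<rho>a. \<exists>\<rho>s. lebesgue_decomposition \<rho> \<sigma> \<rho>a \<rho>s)"

text \<open>
  There is no power with real exponents on \<open>ennreal\<close>. The density is finite almost everywhere for
  finite measures, so the passage through \<open>enn2real\<close> alters the integrand on a null set only.
\<close>

definition hellinger :: "real \<Rightarrow> 'a measure \<Rightarrow> 'a measure \<Rightarrow> ennreal" where
  "hellinger \<alpha> \<rho> \<sigma> = (\<integral>\<^sup>+x. ennreal (enn2real (RN_deriv \<sigma> (ac_part \<rho> \<sigma>) x) powr \<alpha>) \<partial>\<sigma>)"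

text \<open>Values of \<open>\<rho>\<close> are nonnegative, hence the absence of absolute values.\<close>

definition tv_norm :: "'a measure \<Rightarrow> ennreal" where
  "tv_norm \<rho> =
     (SUP P\<in>{P. finite P \<and> partition_on (space \<rho>) P \<and> P \<subseteq> sets \<rho>}. \<Sum>A\<in>P. emeasure \<rho> A)"

definition liminf_left_1 :: "(real \<Rightarrow> nat \<Rightarrow> ennreal) \<Rightarrow> ennreal" where
  "liminf_left_1 f = (SUP (n, \<beta>)\<in>UNIV \<times> {0<..<1}. INF (m, x)\<in>{n..} \<times> {\<beta>..<1}. f x m)"

lemma tv_norm_eq: "tv_norm \<rho> = emeasure \<rho> (space \<rho>)"
proof -
  have *: "(\<Sum>A\<in>P. emeasure \<rho> A) = emeasure \<rho> (space \<rho>)"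
    if "finite P" "partition_on (space \<rho>) P" "P \<subseteq> sets \<rho>" for P
    using that sum_emeasure[of "\<lambda>A. A" P \<rho>]
    by (auto simp: partition_on_def disjoint_family_on_def disjoint_def)
  have "{P. finite P \<and> partition_on (space \<rho>) P \<and> P \<subseteq> sets \<rho>} \<noteq> {}"
  proof (cases "space \<rho> = {}")
    case True
    then show ?thesis by (auto intro!: exI[of _ "{}"] simp: partition_on_def)
  next
    case False
    then show ?thesis by (auto intro!: exI[of _ "{space \<rho>}"] simp: partition_on_def)
  qed
  then show ?thesis
    unfolding tv_norm_def using * by (subst SUP_cong[OF refl, where D="\<lambda>_. emeasure \<rho> (space \<rho>)"]) auto
qed

lemma lebesgue_decomposition_unique:
  assumes "sets \<rho> = sets \<sigma>"
    and 1: "lebesgue_decomposition \<rho> \<sigma> \<rho>a \<rho>s"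
    and 2: "lebesgue_decomposition \<rho> \<sigma> \<rho>a' \<rho>s'"
  shows "\<rho>a = \<rho>a'"
proof -
  obtain N where N: "N \<in> sets \<sigma>" "emeasure \<sigma> N = 0" "emeasure \<rho>s (space \<sigma> - N) = 0"
    using 1 by (auto simp: lebesgue_decomposition_def mutually_singular_def)
  obtain N' where N': "N' \<in> sets \<sigma>" "emeasure \<sigma> N' = 0" "emeasure \<rho>s' (space \<sigma> - N') = 0"
    using 2 by (auto simp: lebesgue_decomposition_def mutually_singular_def)
  have S: "sets \<rho>a = sets \<sigma>" "sets \<rho>s = sets \<sigma>" "sets \<rho>a' = sets \<sigma>" "sets \<rho>s' = sets \<sigma>"
    using 1 2 assms(1) by (auto simp: lebesgue_decomposition_def)
  let ?N = "N \<union> N'"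
  have N0: "?N \<in> null_sets \<sigma>" using N N' by (intro null_sets.Un) auto
  have a0: "?N \<in> null_sets \<rho>a" "?N \<in> null_sets \<rho>a'"
    using 1 2 N0 by (auto simp: lebesgue_decomposition_def absolutely_continuous_def)
  have s0: "space \<sigma> - N \<in> null_sets \<rho>s" "space \<sigma> - N' \<in> null_sets \<rho>s'"
    using N N' S by auto
  show ?thesis
  proof (rule measure_eqI)
    show "sets \<rho>a = sets \<rho>a'" using S by simp
    fix A assume "A \<in> sets \<rho>a"
    then have A: "A \<in> sets \<sigma>" using S by simp
    let ?B = "A - ?N"
    have B: "?B \<in> sets \<sigma>" using A N N' by auto
    have Bs: "?B \<subseteq> space \<sigma> - N" "?B \<subseteq> space \<sigma> - N'" using sets.sets_into_space[OF A] by auto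
    have "emeasure \<rho>s ?B = 0" "emeasure \<rho>s' ?B = 0"
      using null_sets_subset[OF s0(1) _ Bs(1)] null_sets_subset[OF s0(2) _ Bs(2)] B S by auto
    moreover have "emeasure \<rho>a A = emeasure \<rho>a ?B" "emeasure \<rho>a' A = emeasure \<rho>a' ?B"
      using a0 A S by (simp_all add: emeasure_Diff_null_set)
    moreover have "emeasure \<rho> ?B = emeasure \<rho>a ?B + emeasure \<rho>s ?B"
      "emeasure \<rho> ?B = emeasure \<rho>a' ?B + emeasure \<rho>s' ?B"
      using 1 2 B assms(1) unfolding lebesgue_decomposition_def by blast+
    ultimately show "emeasure \<rho>a A = emeasure \<rho>a' A" by simp
  qed
qed

lemma lebesgue_decomposition_exists:
  assumes S: "sets \<rho> = sets \<sigma>" and "finite_measure \<rho>"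
  shows "\<exists>\<rho>a \<rho>s. lebesgue_decomposition \<rho> \<sigma> \<rho>a \<rho>s"
proof -
  interpret finite_measure \<rho> by fact
  have sp: "space \<rho> = space \<sigma>" using S by (rule sets_eq_imp_space_eq)
  let ?s = "SUP N\<in>null_sets \<sigma>. emeasure \<rho> N"
  have "null_sets \<sigma> \<noteq> {}" by auto
  then obtain g :: "nat \<Rightarrow> ennreal"
    where g: "range g \<subseteq> emeasure \<rho> ` null_sets \<sigma>" "?s = (SUP n. g n)"
    using ennreal_SUP_countable_SUP[of "null_sets \<sigma>" "emeasure \<rho>"] by blast
  from g(1) have "\<forall>n. \<exists>N\<in>null_sets \<sigma>. g n = emeasure \<rho> N" by auto
  then obtain h where h: "\<And>n::nat. h n \<in> null_sets \<sigma>" "\<And>n. g n = emeasure \<rho> (h n)" by metis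
  let ?N = "\<Union>n. h n"
  have N: "?N \<in> null_sets \<sigma>" using h by (intro null_sets_UN) auto
  then have N': "?N \<in> sets \<rho>" "?N \<in> sets \<sigma>" using S by auto
  have le: "?s \<le> emeasure \<rho> ?N"
    unfolding g(2) h(2) using N' h(1) S by (intro SUP_least emeasure_mono) auto
  let ?\<rho>a = "density \<rho> (indicator (space \<rho> - ?N))" and ?\<rho>s = "density \<rho> (indicator ?N)"
  have ea: "emeasure ?\<rho>a A = emeasure \<rho> (A - ?N)" if "A \<in> sets \<rho>" for A
  proof -
    have "(space \<rho> - ?N) \<inter> A = A - ?N" using sets.sets_into_space[OF that] by auto
    then show ?thesis
      using that N' by (subst emeasure_density) (auto simp flip: indicator_inter_arith)
  qed
  have es: "emeasure ?\<rho>s A = emeasure \<rho> (A \<inter> ?N)" if "A \<in> sets \<rho>" for A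
  proof -
    have "?N \<inter> A = A \<inter> ?N" by auto
    then show ?thesis
      using that N' by (subst emeasure_density) (auto simp flip: indicator_inter_arith)
  qed
  have "lebesgue_decomposition \<rho> \<sigma> ?\<rho>a ?\<rho>s"
    unfolding lebesgue_decomposition_def
  proof (intro conjI ballI)
    fix A assume A: "A \<in> sets \<rho>"
    have "emeasure \<rho> ((A - ?N) \<union> (A \<inter> ?N)) = emeasure \<rho> (A - ?N) + emeasure \<rho> (A \<inter> ?N)"
      using A N' by (intro plus_emeasure[symmetric]) auto
    also have "(A - ?N) \<union> (A \<inter> ?N) = A" by auto
    finally show "emeasure \<rho> A = emeasure ?\<rho>a A + emeasure ?\<rho>s A"
      using A by (simp only: ea es)
  next
    show "absolutely_continuous \<sigma> ?\<rho>a"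
      unfolding absolutely_continuous_def
    proof
      fix A assume A: "A \<in> null_sets \<sigma>"
      then have A': "A \<in> sets \<rho>" using S by auto
      have "emeasure \<rho> ?N + emeasure \<rho> (A - ?N) = emeasure \<rho> (?N \<union> (A - ?N))"
        using A' N' by (intro plus_emeasure) auto
      also have "\<dots> = emeasure \<rho> (?N \<union> A)" by (rule arg_cong[of _ _ "emeasure \<rho>"]) blast
      also have "\<dots> \<le> ?s" using A N by (intro SUP_upper) (rule null_sets.Un)
      also note le
      finally have "emeasure \<rho> ?N + emeasure \<rho> (A - ?N) \<le> emeasure \<rho> ?N + 0" by simp
      then have "emeasure \<rho> (A - ?N) = 0"
        by (subst (asm) ennreal_add_left_cancel_le) (use emeasure_finite in auto)
      then show "A \<in> null_sets ?\<rho>a" using A' ea[OF A'] by (intro null_setsI) auto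
    qed
    have "space \<rho> - ?N \<in> sets \<rho>" using N' by auto
    moreover have "(space \<rho> - ?N) \<inter> ?N = {}" by blast
    ultimately have "emeasure ?\<rho>s (space \<sigma> - ?N) = 0" using es[of "space \<rho> - ?N"] sp by simp
    then show "mutually_singular ?\<rho>s \<sigma>"
      unfolding mutually_singular_def using N by (intro bexI[of _ ?N]) auto
  qed simp_all
  then show ?thesis by blast
qed

lemma ac_part_lebesgue_decomposition:
  assumes "sets \<rho> = sets \<sigma>" "finite_measure \<rho>"
  shows "\<exists>\<rho>s. lebesgue_decomposition \<rho> \<sigma> (ac_part \<rho> \<sigma>) \<rho>s"
  unfolding ac_part_def
proof (rule theI')
  show "\<exists>!\<rho>a. \<exists>\<rho>s. lebesgue_decomposition \<rho> \<sigma> \<rho>a \<rho>s"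
    using lebesgue_decomposition_exists[OF assms] lebesgue_decomposition_unique[OF assms(1)] by blast
qed

end

theory Submission
  imports Defs "HOL-Real_Asymp.Real_Asymp"
begin

text \<open>
  The \<sigma>-algebras \<open>\<F>\<^bsub>T \<and> V\<^sub>n\<^esub>\<close> increase and generate \<open>\<F>\<^sub>T\<close>: a set of \<open>\<F>\<^sub>T\<close> intersected with
  \<open>{T < V\<^sub>n}\<close> lies in \<open>\<F>\<^bsub>T \<and> V\<^sub>n\<^esub>\<close>, and on \<open>{T = \<infinity>}\<close> one uses that \<open>\<F>\<close> is generated by the \<open>\<F>\<^sub>t\<close>
  with \<open>t < \<infinity>\<close>. With respect to \<open>\<lambda> = \<mu> + \<nu>\<close>, the densities \<open>f\<^sub>n\<close> and \<open>g\<^sub>n\<close> of the restrictions of \<open>\<mu>\<close>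
  and \<open>\<nu>\<close> are conditional expectations of the densities \<open>f\<close> and \<open>g\<close>, so they converge \<open>\<lambda>\<close>-a.e. by
  Levy's upward theorem, which follows from Doob's maximal inequality and approximation in \<open>L\<^sup>1\<close>.
  The derivatives of the absolutely continuous parts are the quotients \<open>z\<^sub>n = f\<^sub>n / g\<^sub>n\<close>, and \<open>g > 0\<close>
  holds \<open>\<nu>\<close>-a.e., hence \<open>z\<^sub>n \<rightarrow> z\<close>. One inequality for the Hellinger integrals is Fatou's lemma; for
  the other, \<open>z\<^sub>n powr \<alpha> \<le> min z\<^sub>n K powr \<alpha> + K powr (\<alpha> - 1) * z\<^sub>n\<close> and \<open>\<integral>z\<^sub>n \<partial>\<nu> \<le> 1\<close> reduce the limit
  in \<open>n\<close>, for fixed \<open>\<alpha> < 1\<close>, to bounded convergence.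
\<close>

subsection \<open>Upward convergence of conditional expectations\<close>

text \<open>The measure is finite rather than a probability, because the locale is later
  instantiated with a measure dominating both \<open>\<mu>\<close> and \<open>\<nu>\<close>.\<close>

locale increasing_subalgebras = finite_measure M for M :: "'a measure" +
  fixes G :: "nat \<Rightarrow> 'a measure"
  assumes subalgebra_G: "\<And>n. subalgebra M (G n)"
    and sets_G_mono: "\<And>m n. m \<le> n \<Longrightarrow> sets (G m) \<subseteq> sets (G n)"
begin

sublocale cond: finite_measure_subalgebra M "G n" for n
  by unfold_locales (rule subalgebra_G)

lemma space_G: "space (G n) = space M"
  using subalgebra_G[of n] by (simp add: subalgebra_def)

lemma measurable_G_mono: "m \<le> n \<Longrightarrow> f \<in> measurable (G m) N \<Longrightarrow> f \<in> measurable (G n) N"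
  using sets_G_mono[of m n] unfolding measurable_def space_G by blast

text \<open>Split the event by the first index at which the level is exceeded. The piece
  \<open>A k\<close> is in \<open>G k\<close>, so the conditional expectation and \<open>h\<close>
  have the same integral over it; the disjoint pieces together give at most the full integral of
  \<open>h\<close>.\<close>

lemma maximal_inequality:
  assumes [measurable]: "h \<in> borel_measurable M"
  shows "\<delta> * emeasure M {x\<in>space M. \<exists>n. nn_cond_exp M (G n) h x > \<delta>} \<le> (\<integral>\<^sup>+x. h x \<partial>M)"
proof -
  define A where "A k = {x\<in>space M. nn_cond_exp M (G k) h x > \<delta> \<and> (\<forall>j<k. nn_cond_exp M (G j) h x \<le> \<delta>)}" for k
  have AG: "A k \<in> sets (G k)" for k
  proof -
    have *: "nn_cond_exp M (G j) h \<in> borel_measurable (G k)" if "j \<le> k" for j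
      using that by (rule measurable_G_mono) simp
    have "A k = {x\<in>space (G k). nn_cond_exp M (G k) h x > \<delta>} \<inter>
      (\<Inter>j\<in>{..<k}. {x\<in>space (G k). nn_cond_exp M (G j) h x \<le> \<delta>}) \<inter> space (G k)"
      by (auto simp: A_def space_G)
    also have "\<dots> \<in> sets (G k)"
    \<comment> \<open>At \<open>k = 0\<close> the inner intersection has an empty index set and is
      all of \<open>UNIV\<close>, so closure under nonempty finite intersections does not
      apply.\<close>
    proof (cases "k = 0")
      case True
      then show ?thesis using *[of k] by (auto intro!: sets.Int borel_measurable_less)
    next
      case False
      then show ?thesis
        using * by (intro sets.Int sets.finite_INT borel_measurable_less borel_measurable_le) auto
    qed
    finally show ?thesis .
  qed
  then have [measurable]: "A k \<in> sets M" for k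
    using subalgebra_G[of k] by (auto simp: subalgebra_def)
  have disj: "disjoint_family A"
    unfolding disjoint_family_on_def
  proof safe
    fix m n x assume "m \<noteq> n" "x \<in> A m" "x \<in> A n"
    then show "x \<in> {}"
      by (cases m n rule: linorder_cases) (force simp: A_def)+
  qed
  have UN: "(\<Union>k. A k) = {x\<in>space M. \<exists>n. nn_cond_exp M (G n) h x > \<delta>}"
  proof safe
    fix x n assume x: "x \<in> space M" and "nn_cond_exp M (G n) h x > \<delta>"
    then have "x \<in> A (LEAST n. nn_cond_exp M (G n) h x > \<delta>)"
      unfolding A_def by (auto intro: LeastI simp: not_less[symmetric] dest: not_less_Least)
    then show "x \<in> (\<Union>k. A k)" by auto
  qed (auto simp: A_def)
  have le: "\<delta> * emeasure M (A k) \<le> (\<integral>\<^sup>+x. h x * indicator (A k) x \<partial>M)" for k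
  proof -
    have "\<delta> * emeasure M (A k) = (\<integral>\<^sup>+x. \<delta> * indicator (A k) x \<partial>M)"
      by (simp add: nn_integral_cmult_indicator)
    also have "\<dots> \<le> (\<integral>\<^sup>+x. indicator (A k) x * nn_cond_exp M (G k) h x \<partial>M)"
      by (intro nn_integral_mono) (auto simp: A_def indicator_def)
    also have "\<dots> = (\<integral>\<^sup>+x. indicator (A k) x * h x \<partial>M)"
      using AG by (intro cond.nn_cond_exp_intg) auto
    finally show ?thesis by (simp add: mult.commute)
  qed
  have "\<delta> * emeasure M (\<Union>k. A k) = (\<Sum>k. \<delta> * emeasure M (A k))"
    using disj by (subst suminf_emeasure[symmetric]) (auto simp: ennreal_suminf_cmult)
  also have "\<dots> \<le> (\<Sum>k. \<integral>\<^sup>+x. h x * indicator (A k) x \<partial>M)"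
    using le by (intro suminf_le) auto
  also have "\<dots> = (\<integral>\<^sup>+x. h x * indicator (\<Union>k. A k) x \<partial>M)"
    using disj by (subst nn_integral_suminf[symmetric]) (auto simp: ennreal_suminf_cmult suminf_indicator)
  also have "\<dots> \<le> (\<integral>\<^sup>+x. h x \<partial>M)"
    by (intro nn_integral_mono) (auto simp: indicator_def)
  finally show ?thesis unfolding UN .
qed

section \<open>Approximation in L1 by functions measurable at a finite stage\<close>

text \<open>Membership in the L1 closure of the functions measurable for some \<open>G m\<close>.
  Such an approximant agrees almost everywhere with its own conditional expectation given
  \<open>G n\<close> for every \<open>n \<ge> m\<close>.\<close>

definition L1_approx :: "('a \<Rightarrow> real) \<Rightarrow> bool" where
  "L1_approx f \<longleftrightarrow> (\<forall>\<epsilon>>0. \<exists>m g. g \<in> borel_measurable (G m) \<and> integrable M g \<and> (\<integral>x. \<bar>f x - g x\<bar> \<partial>M) < \<epsilon>)"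

lemma L1_approx_measurable: "integrable M f \<Longrightarrow> f \<in> borel_measurable (G m) \<Longrightarrow> L1_approx f"
  unfolding L1_approx_def by (intro allI impI exI[of _ m] exI[of _ f]) simp

lemma L1_approx_add:
  assumes [measurable, simp]: "integrable M f" "integrable M f'"
    and f: "L1_approx f" and f': "L1_approx f'"
  shows "L1_approx (\<lambda>x. f x + f' x)"
  unfolding L1_approx_def
proof safe
  fix \<epsilon> :: real assume "\<epsilon> > 0"
  then have "\<epsilon>/2 > 0" by simp
  obtain m g where g: "g \<in> borel_measurable (G m)" "integrable M g" "(\<integral>x. \<bar>f x - g x\<bar> \<partial>M) < \<epsilon>/2"
    using f \<open>\<epsilon>/2 > 0\<close> unfolding L1_approx_def by blast
  obtain m' g' where g': "g' \<in> borel_measurable (G m')" "integrable M g'" "(\<integral>x. \<bar>f' x - g' x\<bar> \<partial>M) < \<epsilon>/2"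
    using f' \<open>\<epsilon>/2 > 0\<close> unfolding L1_approx_def by blast
  have "(\<integral>x. \<bar>f x + f' x - (g x + g' x)\<bar> \<partial>M) \<le> (\<integral>x. \<bar>f x - g x\<bar> + \<bar>f' x - g' x\<bar> \<partial>M)"
    using g(2) g'(2) by (intro integral_mono) auto
  also have "\<dots> < \<epsilon>" using g g' by (subst Bochner_Integration.integral_add) auto
  finally show "\<exists>m g. g \<in> borel_measurable (G m) \<and> integrable M g \<and> (\<integral>x. \<bar>f x + f' x - g x\<bar> \<partial>M) < \<epsilon>"
    using g(2) g'(2) measurable_G_mono[OF max.cobounded1 g(1)] measurable_G_mono[OF max.cobounded2 g'(1)]
    by (intro exI[of _ "max m m'"] exI[of _ "\<lambda>x. g x + g' x"] conjI borel_measurable_add) simp_all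
qed

lemma L1_approx_cmult:
  assumes f: "L1_approx f"
  shows "L1_approx (\<lambda>x. c * f x)"
  unfolding L1_approx_def
proof safe
  fix \<epsilon> :: real assume "\<epsilon> > 0"
  \<comment> \<open>The \<open>+ 1\<close> keeps the denominator positive when
    \<open>c = 0\<close>.\<close>
  then have "\<epsilon> / (\<bar>c\<bar> + 1) > 0" by (simp add: add_nonneg_pos)
  then obtain m g where g: "g \<in> borel_measurable (G m)" "integrable M g"
    "(\<integral>x. \<bar>f x - g x\<bar> \<partial>M) < \<epsilon> / (\<bar>c\<bar> + 1)"
    using f unfolding L1_approx_def by blast
  have "(\<integral>x. \<bar>c * f x - c * g x\<bar> \<partial>M) = \<bar>c\<bar> * (\<integral>x. \<bar>f x - g x\<bar> \<partial>M)"
    by (simp add: abs_mult flip: right_diff_distrib)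
  also have "\<dots> \<le> (\<bar>c\<bar> + 1) * (\<integral>x. \<bar>f x - g x\<bar> \<partial>M)"
    by (intro mult_right_mono) auto
  also have "\<dots> < \<epsilon>"
    using g(3) by (simp add: pos_less_divide_eq mult.commute add_nonneg_pos)
  finally show "\<exists>m g. g \<in> borel_measurable (G m) \<and> integrable M g \<and> (\<integral>x. \<bar>c * f x - g x\<bar> \<partial>M) < \<epsilon>"
    using g by (intro exI[of _ m] exI[of _ "\<lambda>x. c * g x"]) auto
qed

text \<open>By dominated convergence \<open>s i\<close> tends to \<open>f\<close> in L1, so an
  approximant of a late \<open>s i\<close> serves for \<open>f\<close>. Both the disjoint unions and
  \<open>integrable_induct\<close> deliver their limits in this form.\<close>

lemma L1_approx_lim:
  fixes s :: "nat \<Rightarrow> 'a \<Rightarrow> real"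
  assumes s: "\<And>i. integrable M (s i)" "\<And>i. L1_approx (s i)"
    and lim: "\<And>x. x \<in> space M \<Longrightarrow> (\<lambda>i. s i x) \<longlonglongrightarrow> f x"
    and bound: "\<And>i x. x \<in> space M \<Longrightarrow> norm (s i x) \<le> w x"
    and w: "integrable M w" and f: "integrable M f"
  shows "L1_approx f"
  unfolding L1_approx_def
proof safe
  fix \<epsilon> :: real assume "\<epsilon> > 0"
  then have "\<epsilon>/2 > 0" by simp
  have "(\<lambda>i. \<integral>x. \<bar>f x - s i x\<bar> \<partial>M) \<longlonglongrightarrow> (\<integral>x. 0 \<partial>M)"
  proof (rule integral_dominated_convergence)
    show "integrable M (\<lambda>x. \<bar>f x\<bar> + w x)" using w f by auto
    show "AE x in M. (\<lambda>i. \<bar>f x - s i x\<bar>) \<longlonglongrightarrow> 0"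
    proof (rule AE_I2)
      fix x assume "x \<in> space M"
      from lim[OF this] have "(\<lambda>i. \<bar>f x - s i x\<bar>) \<longlonglongrightarrow> \<bar>f x - f x\<bar>" by (intro tendsto_intros)
      then show "(\<lambda>i. \<bar>f x - s i x\<bar>) \<longlonglongrightarrow> 0" by simp
    qed
    show "AE x in M. norm \<bar>f x - s i x\<bar> \<le> \<bar>f x\<bar> + w x" for i
      using bound[of _ i] by (intro AE_I2) force
  qed (use s f in auto)
  then have "\<forall>\<^sub>F i in sequentially. (\<integral>x. \<bar>f x - s i x\<bar> \<partial>M) < \<epsilon>/2"
    using \<open>\<epsilon>/2 > 0\<close> by (intro order_tendstoD(2)) auto
  then obtain i where i: "(\<integral>x. \<bar>f x - s i x\<bar> \<partial>M) < \<epsilon>/2"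
    by (auto simp: eventually_sequentially)
  obtain m g where g: "g \<in> borel_measurable (G m)" "integrable M g" "(\<integral>x. \<bar>s i x - g x\<bar> \<partial>M) < \<epsilon>/2"
    using s(2)[of i] \<open>\<epsilon>/2 > 0\<close> unfolding L1_approx_def by blast
  have "(\<integral>x. \<bar>f x - g x\<bar> \<partial>M) \<le> (\<integral>x. \<bar>f x - s i x\<bar> + \<bar>s i x - g x\<bar> \<partial>M)"
    using g(2) f s(1)[of i] by (intro integral_mono) auto
  also have "\<dots> < \<epsilon>" using g f i s(1)[of i] by (subst Bochner_Integration.integral_add) auto
  finally show "\<exists>m g. g \<in> borel_measurable (G m) \<and> integrable M g \<and> (\<integral>x. \<bar>f x - g x\<bar> \<partial>M) < \<epsilon>"
    using g by blast
qed

lemma L1_approx_cong: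
  assumes "\<And>x. x \<in> space M \<Longrightarrow> f x = f' x" and "L1_approx f"
  shows "L1_approx f'"
proof -
  have "(\<integral>x. \<bar>f x - g x\<bar> \<partial>M) = (\<integral>x. \<bar>f' x - g x\<bar> \<partial>M)" for g
    using assms(1) by (intro Bochner_Integration.integral_cong) auto
  then show ?thesis using assms(2) unfolding L1_approx_def by simp
qed

text \<open>Dynkin's argument: since the \<open>G n\<close> increase, their union is an
  intersection-stable generator, and the sets with approximable indicator are closed under
  complements and countable disjoint unions.\<close>

lemma L1_approx_indicator:
  assumes gen: "sets M = sigma_sets (space M) (\<Union>n. sets (G n))" and A: "A \<in> sets M"
  shows "L1_approx (indicator A)"
proof -
  have "Int_stable (\<Union>n. sets (G n))"
  proof (rule Int_stableI)
    fix a b assume "a \<in> (\<Union>n. sets (G n))" "b \<in> (\<Union>n. sets (G n))"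
    then obtain m n where "a \<in> sets (G m)" "b \<in> sets (G n)" by auto
    then have "a \<in> sets (G (max m n))" "b \<in> sets (G (max m n))"
      using sets_G_mono[of m "max m n"] sets_G_mono[of n "max m n"] by auto
    then show "a \<inter> b \<in> (\<Union>n. sets (G n))" by blast
  qed
  moreover have "(\<Union>n. sets (G n)) \<subseteq> Pow (space M)"
    by (rule UN_least) (metis sets.space_closed space_G)
  moreover have "A \<in> sigma_sets (space M) (\<Union>n. sets (G n))" using A gen by simp
  ultimately show ?thesis
  proof (induction rule: sigma_sets_induct_disjoint)
    case (basic A)
    then obtain m where m: "A \<in> sets (G m)" by auto
    then have "A \<in> sets M" using subalgebra_G[of m] by (auto simp: subalgebra_def)
    with m show ?case by (intro L1_approx_measurable[of _ m]) (auto intro: less_top emeasure_finite simp: emeasure_eq_measure)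
  next
    case empty
    show ?case by (intro L1_approx_measurable[of _ 0]) auto
  next
    case (compl A)
    then have [measurable]: "A \<in> sets M" using gen by simp
    have "L1_approx (\<lambda>x. 1 + (-1) * indicator A x)"
      using compl by (intro L1_approx_add L1_approx_cmult L1_approx_measurable[of "\<lambda>_. 1" 0])
        (auto simp: emeasure_eq_measure)
    then show ?case by (rule L1_approx_cong[rotated]) (auto simp: indicator_def)
  next
    case (union A)
    then have [measurable]: "A i \<in> sets M" for i using gen by auto
    have int: "integrable M (indicator (A i) :: 'a \<Rightarrow> real)" for i by (auto simp: emeasure_eq_measure)
    have s: "L1_approx (\<lambda>x. \<Sum>i<n. indicator (A i) x)" for n
    proof (induction n)
      case 0
      show ?case by (intro L1_approx_measurable[of _ 0]) auto
    next
      case (Suc n)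
      then show ?case using int union.IH by (auto intro!: L1_approx_add)
    qed
    \<comment> \<open>Disjointness turns the partial sums into indicators of finite unions, which
      are bounded by 1 and converge to the indicator of the whole union.\<close>
    have e: "(\<Sum>i<n. indicator (A i) x) = (indicator (\<Union>i<n. A i) x :: real)" for n x
      using union(1) by (intro indicator_UN_disjoint[symmetric])
        (auto intro: disjoint_family_on_mono)
    show ?case
    proof (rule L1_approx_lim)
      fix x assume "x \<in> space M"
      show "(\<lambda>n. \<Sum>i<n. indicator (A i) x) \<longlonglongrightarrow> (indicator (\<Union> (range A)) x :: real)"
        unfolding e by (rule LIMSEQ_indicator_UN)
    next
      show "norm (\<Sum>i<n. indicator (A i) x :: real) \<le> (\<lambda>_. 1) x" for n x
        unfolding e by (auto simp: indicator_def)
    qed (use s int in \<open>auto simp: emeasure_eq_measure\<close>)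
  qed
qed

lemma L1_approx_integrable:
  assumes gen: "sets M = sigma_sets (space M) (\<Union>n. sets (G n))" and "integrable M f"
  shows "L1_approx f"
  using assms(2)
proof (induction rule: integrable_induct)
  case (base A c)
  then show ?case
    using L1_approx_cmult[OF L1_approx_indicator[OF gen], of A c] by (simp add: mult.commute)
next
  case (add f g)
  then show ?case by (intro L1_approx_add)
next
  case (lim f s)
  show ?case
    by (rule L1_approx_lim[OF lim.hyps(1) lim.IH lim.hyps(2,3)]) (use lim.hyps(4) in auto)
qed

text \<open>For an L1 approximant \<open>g\<close> measurable for \<open>G m\<close>, the error at
  \<open>n \<ge> m\<close> is the conditional expectation of \<open>f - g\<close> minus
  \<open>f - g\<close> itself. The maximal inequality controls the first term for all
  \<open>n\<close> at once, Markov's inequality the second.\<close>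

theorem levy_upward:
  assumes gen: "sets M = sigma_sets (space M) (\<Union>n. sets (G n))" and f: "integrable M f"
  shows "AE x in M. (\<lambda>n. real_cond_exp M (G n) f x) \<longlonglongrightarrow> f x"
proof -
  have [measurable]: "f \<in> borel_measurable M" using f by simp
  have ev: "AE x in M. \<exists>m. \<forall>n\<ge>m. \<bar>real_cond_exp M (G n) f x - f x\<bar> \<le> 2 * \<delta>" if "\<delta> > 0" for \<delta> :: real
  proof -
    \<comment> \<open>On \<open>B\<close> the error exceeds \<open>2 * \<delta>\<close> infinitely
      often; one \<open>\<delta>\<close> is reserved for each of the two terms.\<close>
    define B where "B = {x\<in>space M. \<not> (\<exists>m. \<forall>n\<ge>m. \<bar>real_cond_exp M (G n) f x - f x\<bar> \<le> 2 * \<delta>)}"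
    have [measurable]: "B \<in> sets M" unfolding B_def by measurable
    \<comment> \<open>The maximal and the Markov inequality cost \<open>\<epsilon>\<close> each. As
      \<open>B\<close> does not depend on the approximant, \<open>\<epsilon>\<close> may tend to 0
      afterwards with \<open>\<delta>\<close> fixed.\<close>
    have bound: "ennreal \<delta> * emeasure M B \<le> ennreal (2 * \<epsilon>)" if "\<epsilon> > 0" for \<epsilon> :: real
    proof -
      obtain m g where g: "g \<in> borel_measurable (G m)" "integrable M g" "(\<integral>x. \<bar>f x - g x\<bar> \<partial>M) < \<epsilon>"
        using L1_approx_integrable[OF gen f] \<open>\<epsilon> > 0\<close> unfolding L1_approx_def by blast
      have [measurable]: "g \<in> borel_measurable M" using g(2) by simp
      define h where "h x = ennreal \<bar>f x - g x\<bar>" for x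
      have [measurable]: "h \<in> borel_measurable M" unfolding h_def by simp
      have h: "(\<integral>\<^sup>+x. h x \<partial>M) \<le> ennreal \<epsilon>"
        unfolding h_def using f g by (subst nn_integral_eq_integral) (auto intro!: ennreal_leI)
      let ?C = "{x\<in>space M. \<exists>n. nn_cond_exp M (G n) h x > ennreal \<delta>}" and ?D = "{x\<in>space M. h x > ennreal \<delta>}"
      have "AE x in M. \<forall>n\<ge>m. real_cond_exp M (G n) f x - g x = real_cond_exp M (G n) (\<lambda>x. f x - g x) x"
      proof -
        have "AE x in M. real_cond_exp M (G n) f x - g x = real_cond_exp M (G n) (\<lambda>x. f x - g x) x" if "m \<le> n" for n
          using cond.real_cond_exp_diff[OF f g(2), of n]
            cond.real_cond_exp_F_meas[OF g(2) measurable_G_mono[OF that g(1)]]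
          by eventually_elim simp
        then show ?thesis by (auto simp: AE_all_countable)
      qed
      \<comment> \<open>Passing to the nonnegative \<open>h\<close> makes the maximal inequality
        available for the signed function \<open>f - g\<close>.\<close>
      moreover have "AE x in M. \<forall>n. ennreal \<bar>real_cond_exp M (G n) (\<lambda>x. f x - g x) x\<bar> \<le> nn_cond_exp M (G n) h x"
        unfolding AE_all_countable h_def by (intro allI cond.real_cond_exp_abs) simp
      ultimately have "AE x in M. x \<in> B \<longrightarrow> x \<in> ?C \<union> ?D"
      proof eventually_elim
        case (elim x)
        show ?case
        proof (rule impI, rule ccontr)
          assume B: "x \<in> B" and "x \<notin> ?C \<union> ?D"
          then have C: "\<And>n. nn_cond_exp M (G n) h x \<le> ennreal \<delta>" and D: "h x \<le> ennreal \<delta>"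
            by (auto simp: B_def not_less)
          have "\<bar>real_cond_exp M (G n) f x - f x\<bar> \<le> 2 * \<delta>" if "n \<ge> m" for n
          proof -
            have "ennreal \<bar>real_cond_exp M (G n) (\<lambda>x. f x - g x) x\<bar> \<le> ennreal \<delta>"
              using elim(2) C order_trans by blast
            then have "\<bar>real_cond_exp M (G n) f x - g x\<bar> \<le> \<delta>"
              using elim(1) that \<open>\<delta> > 0\<close> by simp
            moreover have "\<bar>f x - g x\<bar> \<le> \<delta>" using D \<open>\<delta> > 0\<close> by (simp add: h_def)
            ultimately show ?thesis by linarith
          qed
          then show False using B by (auto simp: B_def)
        qed
      qed
      then have "emeasure M B \<le> emeasure M (?C \<union> ?D)"
        by (intro emeasure_mono_AE) auto
      also have "\<dots> \<le> emeasure M ?C + emeasure M ?D"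
        by (intro emeasure_subadditive) auto
      finally have "ennreal \<delta> * emeasure M B \<le> ennreal \<delta> * (emeasure M ?C + emeasure M ?D)"
        by (rule mult_left_mono) simp
      also have "\<dots> = ennreal \<delta> * emeasure M ?C + ennreal \<delta> * emeasure M ?D"
        by (rule distrib_left)
      also have "ennreal \<delta> * emeasure M ?C \<le> ennreal \<epsilon>"
        using maximal_inequality[of h "ennreal \<delta>"] h by simp
      also have "ennreal \<delta> * emeasure M ?D \<le> (\<integral>\<^sup>+x. h x \<partial>M)"
      proof -
        have "ennreal \<delta> * emeasure M ?D = (\<integral>\<^sup>+x. ennreal \<delta> * indicator ?D x \<partial>M)"
          by (subst nn_integral_cmult_indicator) auto
        also have "\<dots> \<le> (\<integral>\<^sup>+x. h x \<partial>M)" by (intro nn_integral_mono) (auto simp: indicator_def)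
        finally show ?thesis .
      qed
      also note h
      finally show ?thesis using \<open>\<epsilon> > 0\<close> by (simp flip: ennreal_plus add: add_mono)
    qed
    have "ennreal \<delta> * emeasure M B \<le> 0"
    proof (rule ennreal_le_epsilon)
      fix e :: real assume "0 < e"
      then show "ennreal \<delta> * emeasure M B \<le> 0 + ennreal e" using bound[of "e/2"] by simp
    qed
    then have "emeasure M B = 0" using \<open>\<delta> > 0\<close> by simp
    then show ?thesis by (intro AE_I[of _ _ B]) (auto simp: B_def)
  qed
  \<comment> \<open>Countably many values of \<open>\<delta>\<close> suffice for convergence, so the
    exceptional null sets can be united.\<close>
  have "AE x in M. \<forall>k::nat. \<exists>m. \<forall>n\<ge>m. \<bar>real_cond_exp M (G n) f x - f x\<bar> \<le> 2 * (1 / real (Suc k))"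
    unfolding AE_all_countable by (intro allI ev) simp
  then show ?thesis
  proof eventually_elim
    case (elim x)
    show ?case
    proof (rule LIMSEQ_I)
      fix r :: real assume "r > 0"
      then obtain k where "1 / real (Suc k) < r/2" using reals_Archimedean[of "r/2"] by (auto simp: inverse_eq_divide)
      moreover obtain m where "\<forall>n\<ge>m. \<bar>real_cond_exp M (G n) f x - f x\<bar> \<le> 2 * (1 / real (Suc k))"
        using elim by blast
      ultimately show "\<exists>no. \<forall>n\<ge>no. norm (real_cond_exp M (G n) f x - f x) < r"
        by (intro exI[of _ m]) force
    qed
  qed
qed

end

subsection \<open>Densities of absolutely continuous parts\<close>

text \<open>A real-valued density is wanted because \<open>real_cond_exp\<close> acts on real
  functions. As \<open>\<rho>\<close> is finite, its derivative is finite almost everywhere, so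
  \<open>enn2real\<close> changes it only on a null set.\<close>

lemma density_real_RN_deriv:
  assumes M: "finite_measure M" and \<rho>: "finite_measure \<rho>"
    and ac: "absolutely_continuous M \<rho>" "sets \<rho> = sets M"
  obtains f :: "'a \<Rightarrow> real"
  where "integrable M f" "\<And>x. 0 \<le> f x" "density M (\<lambda>x. ennreal (f x)) = \<rho>"
proof
  interpret M: finite_measure M by fact
  interpret \<rho>: finite_measure \<rho> by fact
  let ?f = "\<lambda>x. enn2real (RN_deriv M \<rho> x)"
  have "AE x in M. RN_deriv M \<rho> x \<noteq> \<infinity>"
    using ac by (intro M.RN_deriv_finite) unfold_locales
  then have "AE x in M. ennreal (?f x) = RN_deriv M \<rho> x"
    by eventually_elim (simp add: less_top)
  then have "density M (\<lambda>x. ennreal (?f x)) = density M (RN_deriv M \<rho>)"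
    by (intro density_cong) auto
  also have "\<dots> = \<rho>" using ac by (rule M.density_RN_deriv)
  finally show d: "density M (\<lambda>x. ennreal (?f x)) = \<rho>" .
  show "0 \<le> ?f x" for x by simp
  have "(\<integral>\<^sup>+x. ennreal (?f x) \<partial>M) = (\<integral>\<^sup>+x. ennreal (?f x) * indicator (space M) x \<partial>M)"
    by (intro nn_integral_cong) simp
  also have "\<dots> = emeasure (density M (\<lambda>x. ennreal (?f x))) (space M)"
    by (subst emeasure_density) auto
  also have "\<dots> < \<infinity>" unfolding d by (simp add: less_top[symmetric])
  finally show "integrable M ?f" by (intro integrableI_nonneg) auto
qed

lemma common_density:
  assumes \<mu>: "finite_measure \<mu>" and \<nu>: "finite_measure \<nu>" and S: "sets \<mu> = sets \<nu>"
  obtains M and f g :: "'a \<Rightarrow> real"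
  where "finite_measure M" "sets M = sets \<nu>" "integrable M f" "integrable M g"
    "\<And>x. 0 \<le> f x" "\<And>x. 0 \<le> g x"
    "density M (\<lambda>x. ennreal (f x)) = \<mu>" "density M (\<lambda>x. ennreal (g x)) = \<nu>"
proof -
  interpret \<mu>: finite_measure \<mu> by fact
  interpret \<nu>: finite_measure \<nu> by fact
  \<comment> \<open>The dominating measure is the sum of the two; a set null for it is null for each
    summand.\<close>
  define M where "M = measure_of (space \<nu>) (sets \<nu>) (\<lambda>A. emeasure \<mu> A + emeasure \<nu> A)"
  have sM: "sets M = sets \<nu>" and spM: "space M = space \<nu>"
    unfolding M_def by (simp_all add: sets.space_closed)
  have eM: "emeasure M A = emeasure \<mu> A + emeasure \<nu> A" if "A \<in> sets \<nu>" for A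
  proof (rule emeasure_measure_of[OF M_def])
    show "countably_additive (sets M) (\<lambda>A. emeasure \<mu> A + emeasure \<nu> A)"
      unfolding countably_additive_def
    proof safe
      fix A :: "nat \<Rightarrow> 'a set"
      assume A: "range A \<subseteq> sets M" "disjoint_family A"
      have "(\<Sum>i. emeasure \<mu> (A i) + emeasure \<nu> (A i)) = (\<Sum>i. emeasure \<mu> (A i)) + (\<Sum>i. emeasure \<nu> (A i))"
        by (intro suminf_add[symmetric]) auto
      also have "\<dots> = emeasure \<mu> (\<Union>i. A i) + emeasure \<nu> (\<Union>i. A i)"
        using A S sM by (simp add: suminf_emeasure)
      finally show "(\<Sum>i. emeasure \<mu> (A i) + emeasure \<nu> (A i)) = emeasure \<mu> (\<Union>i. A i) + emeasure \<nu> (\<Union>i. A i)" .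
    qed
  qed (use that sM sets.space_closed in \<open>auto simp: positive_def\<close>)
  have fM: "finite_measure M"
    by (rule finite_measureI) (simp add: spM eM \<mu>.emeasure_finite \<nu>.emeasure_finite)
  have ac: "absolutely_continuous M \<mu>" "absolutely_continuous M \<nu>"
    unfolding absolutely_continuous_def using S sM eM by (auto simp: null_sets_def)
  obtain f :: "'a \<Rightarrow> real" where f: "integrable M f" "\<And>x. 0 \<le> f x" "density M (\<lambda>x. ennreal (f x)) = \<mu>"
    using density_real_RN_deriv[OF fM \<mu> ac(1)] S sM by auto
  obtain g :: "'a \<Rightarrow> real" where g: "integrable M g" "\<And>x. 0 \<le> g x" "density M (\<lambda>x. ennreal (g x)) = \<nu>"
    using density_real_RN_deriv[OF fM \<nu> ac(2)] sM by auto
  show ?thesis by (rule that[OF fM sM f(1) g(1) f(2) g(2) f(3) g(3)])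
qed

lemma ac_part_eqI:
  assumes "sets \<rho> = sets \<sigma>" and "lebesgue_decomposition \<rho> \<sigma> \<rho>a \<rho>s"
  shows "ac_part \<rho> \<sigma> = \<rho>a"
  unfolding ac_part_def
  using assms by (intro the_equality) (auto dest: lebesgue_decomposition_unique)

text \<open>The decomposition cuts the space along \<open>{g = 0}\<close>. This set is null for
  \<open>density M g\<close> and carries the singular part; off it the quotient \<open>f / g\<close>
  is the density.\<close>

lemma ac_part_density:
  fixes f g :: "'a \<Rightarrow> ennreal"
  assumes [measurable]: "f \<in> borel_measurable M" "g \<in> borel_measurable M" and fin: "\<And>x. g x < \<infinity>"
  shows "ac_part (density M f) (density M g) = density (density M g) (\<lambda>x. f x / g x)"
proof (rule ac_part_eqI)
  let ?N = "{x\<in>space M. g x = 0}"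
  have eq: "density (density M g) (\<lambda>x. f x / g x) = density M (\<lambda>x. f x * indicator (space M - ?N) x)"
  proof -
    have "density (density M g) (\<lambda>x. f x / g x) = density M (\<lambda>x. g x * (f x / g x))"
      by (rule density_density_eq) auto
    also have "\<dots> = density M (\<lambda>x. f x * indicator (space M - ?N) x)"
    proof (rule density_cong, simp, simp, rule AE_I2)
      \<comment> \<open>Where \<open>g x = 0\<close>, the factor \<open>g x\<close> annihilates
        whatever value division by zero gives; elsewhere finiteness of \<open>g x\<close> permits
        cancellation.\<close>
      fix x assume "x \<in> space M"
      then show "g x * (f x / g x) = f x * indicator (space M - ?N) x"
        using fin[of x] by (cases "g x = 0")
          (simp_all add: ennreal_times_divide ennreal_mult_divide_eq mult.commute[of "g x"])
    qed
    finally show ?thesis .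
  qed
  show "lebesgue_decomposition (density M f) (density M g) (density (density M g) (\<lambda>x. f x / g x))
    (density M (\<lambda>x. f x * indicator ?N x))"
    unfolding lebesgue_decomposition_def
  proof (intro conjI ballI)
    fix A assume "A \<in> sets (density M f)"
    then have [measurable]: "A \<in> sets M" by simp
    have "(\<integral>\<^sup>+x. f x * indicator A x \<partial>M) = (\<integral>\<^sup>+x. f x * indicator (space M - ?N) x * indicator A x
      + f x * indicator ?N x * indicator A x \<partial>M)"
      by (intro nn_integral_cong) (auto simp: indicator_def)
    then show "emeasure (density M f) A = emeasure (density (density M g) (\<lambda>x. f x / g x)) A
      + emeasure (density M (\<lambda>x. f x * indicator ?N x)) A"
      unfolding eq by (simp add: emeasure_density nn_integral_add)
  next
    show "absolutely_continuous (density M g) (density (density M g) (\<lambda>x. f x / g x))"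
      by (intro absolutely_continuousI_density) simp
  next
    have "emeasure (density M g) ?N = 0"
      by (subst emeasure_density) (auto simp: nn_integral_0_iff_AE indicator_def)
    moreover have "emeasure (density M (\<lambda>x. f x * indicator ?N x)) (space M - ?N) = 0"
      by (subst emeasure_density) (auto simp: nn_integral_0_iff_AE indicator_def)
    ultimately show "mutually_singular (density M (\<lambda>x. f x * indicator ?N x)) (density M g)"
      unfolding mutually_singular_def by (intro bexI[of _ ?N]) auto
  qed simp_all
qed simp

lemma RN_deriv_ac_part_density:
  fixes f g :: "'a \<Rightarrow> ennreal"
  assumes M: "sigma_finite_measure (density M g)"
    and [measurable]: "f \<in> borel_measurable M" "g \<in> borel_measurable M" and fin: "\<And>x. g x < \<infinity>"
  shows "AE x in density M g. RN_deriv (density M g) (ac_part (density M f) (density M g)) x = f x / g x"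
  using sigma_finite_measure.RN_deriv_unique[OF M, OF _ ac_part_density[OF assms(2-4), symmetric]]
  by auto

text \<open>Over each \<open>A\<close> in \<open>F\<close>, the function \<open>f\<close> and its
  conditional expectation have the same integral. The proof passes through Bochner integrals, in
  which that identity is stated, and back, since both integrands are nonnegative almost
  everywhere.\<close>

lemma (in sigma_finite_subalgebra) restr_to_subalg_density:
  fixes f :: "'a \<Rightarrow> real"
  assumes f: "integrable M f" "\<And>x. 0 \<le> f x"
  shows "restr_to_subalg (density M (\<lambda>x. ennreal (f x))) F =
    density (restr_to_subalg M F) (\<lambda>x. ennreal (real_cond_exp M F f x))"
proof (rule measure_eqI)
  have [measurable]: "f \<in> borel_measurable M" using f by simp
  have sub: "subalgebra (density M (\<lambda>x. ennreal (f x))) F"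
    using subalg by (simp add: subalgebra_def)
  show "sets (restr_to_subalg (density M (\<lambda>x. ennreal (f x))) F) =
    sets (density (restr_to_subalg M F) (\<lambda>x. ennreal (real_cond_exp M F f x)))"
    by (simp add: sets_restr_to_subalg sub subalg)
  fix A assume "A \<in> sets (restr_to_subalg (density M (\<lambda>x. ennreal (f x))) F)"
  then have A: "A \<in> sets F" by (simp add: sets_restr_to_subalg sub)
  then have [measurable]: "A \<in> sets M" using subalg by (auto simp: subalgebra_def)
  have [measurable]: "real_cond_exp M F f \<in> borel_measurable (restr_to_subalg M F)"
    by (rule measurable_in_subalg[OF subalg]) simp
  have pos: "AE x in M. 0 \<le> real_cond_exp M F f x" using f by (intro real_cond_exp_pos) auto
  have "emeasure (restr_to_subalg (density M (\<lambda>x. ennreal (f x))) F) A =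
    (\<integral>\<^sup>+x. ennreal (f x) * indicator A x \<partial>M)"
    using A by (simp add: emeasure_restr_to_subalg[OF sub] emeasure_density)
  also have "\<dots> = (\<integral>\<^sup>+x. ennreal (indicator A x * f x) \<partial>M)"
    by (intro nn_integral_cong) (auto simp: indicator_def)
  also have "\<dots> = ennreal (\<integral>x. indicator A x * f x \<partial>M)"
    using f integrable_mult_indicator[of A M f] by (intro nn_integral_eq_integral) auto
  also have "(\<integral>x. indicator A x * f x \<partial>M) = (\<integral>x. indicator A x * real_cond_exp M F f x \<partial>M)"
    using real_cond_exp_intA[OF f(1) A] by (simp add: set_lebesgue_integral_def)
  also have "ennreal \<dots> = (\<integral>\<^sup>+x. ennreal (indicator A x * real_cond_exp M F f x) \<partial>M)"
    using f integrable_mult_indicator[of A M "real_cond_exp M F f"] real_cond_exp_int(1)[OF f(1)] pos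
    by (intro nn_integral_eq_integral[symmetric]) (auto elim!: eventually_mono)
  also have "\<dots> = (\<integral>\<^sup>+x. ennreal (real_cond_exp M F f x) * indicator A x \<partial>M)"
    by (intro nn_integral_cong) (auto simp: indicator_def)
  also have "\<dots> = (\<integral>\<^sup>+x. ennreal (real_cond_exp M F f x) * indicator A x \<partial>restr_to_subalg M F)"
    using A by (intro nn_integral_subalgebra2[symmetric] subalg borel_measurable_times_ennreal
        borel_measurable_indicator) simp_all
  also have "\<dots> = emeasure (density (restr_to_subalg M F) (\<lambda>x. ennreal (real_cond_exp M F f x))) A"
    using A by (subst emeasure_density) (auto simp: sets_restr_to_subalg subalg)
  finally show "emeasure (restr_to_subalg (density M (\<lambda>x. ennreal (f x))) F) A =
    emeasure (density (restr_to_subalg M F) (\<lambda>x. ennreal (real_cond_exp M F f x))) A" .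
qed

text \<open>Working with an abstract increasing and generating sequence \<open>G\<close> separates
  the measure theory from the stopping times.\<close>

theorem RN_deriv_ac_part_tendsto:
  fixes G :: "nat \<Rightarrow> 'a measure"
  assumes \<mu>: "finite_measure \<mu>" and \<nu>: "finite_measure \<nu>" and S: "sets \<mu> = sets \<nu>"
    and sub: "\<And>n. subalgebra \<nu> (G n)"
    and mono: "\<And>m n. m \<le> n \<Longrightarrow> sets (G m) \<subseteq> sets (G n)"
    and gen: "sets \<nu> = sigma_sets (space \<nu>) (\<Union>n. sets (G n))"
  shows "AE x in \<nu>. (\<lambda>n. RN_deriv (restr_to_subalg \<nu> (G n))
      (ac_part (restr_to_subalg \<mu> (G n)) (restr_to_subalg \<nu> (G n))) x)
    \<longlonglongrightarrow> RN_deriv \<nu> (ac_part \<mu> \<nu>) x"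
proof -
  obtain M and f g :: "'a \<Rightarrow> real" where M: "finite_measure M" "sets M = sets \<nu>"
    and int: "integrable M f" "integrable M g"
    and pos: "\<And>x. 0 \<le> f x" "\<And>x. 0 \<le> g x"
    and \<mu>_eq: "density M (\<lambda>x. ennreal (f x)) = \<mu>" and \<nu>_eq: "density M (\<lambda>x. ennreal (g x)) = \<nu>"
    using common_density[OF \<mu> \<nu> S] by blast
  have sp: "space M = space \<nu>" using M(2) by (rule sets_eq_imp_space_eq)
  have [measurable]: "f \<in> borel_measurable M" "g \<in> borel_measurable M" using int by auto
  interpret M: finite_measure M by fact
  interpret \<nu>: finite_measure \<nu> by fact
  interpret increasing_subalgebras M G
    using sub mono M(2) sp by unfold_locales (auto simp: subalgebra_def)
  let ?f = "\<lambda>n. real_cond_exp M (G n) f" and ?g = "\<lambda>n. real_cond_exp M (G n) g"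
  have gen': "sets M = sigma_sets (space M) (\<Union>n. sets (G n))" using gen M(2) sp by simp
  have to_\<nu>: "AE x in \<nu>. P x" if "AE x in M. P x" for P
    using that unfolding \<nu>_eq[symmetric] by (subst AE_density) (auto elim: eventually_mono)
  have "AE x in \<nu>. RN_deriv (restr_to_subalg \<nu> (G n))
      (ac_part (restr_to_subalg \<mu> (G n)) (restr_to_subalg \<nu> (G n))) x = ennreal (?f n x) / ennreal (?g n x)" for n
  proof (rule AE_restr_to_subalg[OF sub])
    have m: "?f n \<in> borel_measurable (restr_to_subalg M (G n))" "?g n \<in> borel_measurable (restr_to_subalg M (G n))"
      by (auto intro!: measurable_in_subalg subalgebra_G)
    have eq: "restr_to_subalg \<mu> (G n) = density (restr_to_subalg M (G n)) (\<lambda>x. ennreal (?f n x))"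
      "restr_to_subalg \<nu> (G n) = density (restr_to_subalg M (G n)) (\<lambda>x. ennreal (?g n x))"
      unfolding \<mu>_eq[symmetric] \<nu>_eq[symmetric]
      by (rule cond.restr_to_subalg_density[OF int(1) pos(1)] cond.restr_to_subalg_density[OF int(2) pos(2)])+
    have "finite_measure (restr_to_subalg \<nu> (G n))"
      using sub \<nu> by (rule finite_measure_restr_to_subalg)
    then have "sigma_finite_measure (restr_to_subalg \<nu> (G n))"
      by (rule finite_measure.axioms)
    then show "AE x in restr_to_subalg \<nu> (G n). RN_deriv (restr_to_subalg \<nu> (G n))
      (ac_part (restr_to_subalg \<mu> (G n)) (restr_to_subalg \<nu> (G n))) x = ennreal (?f n x) / ennreal (?g n x)"
      unfolding eq using m by (intro RN_deriv_ac_part_density) auto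
  qed
  then have "AE x in \<nu>. \<forall>n. RN_deriv (restr_to_subalg \<nu> (G n))
      (ac_part (restr_to_subalg \<mu> (G n)) (restr_to_subalg \<nu> (G n))) x = ennreal (?f n x) / ennreal (?g n x)"
    by (simp add: AE_all_countable)
  moreover have "AE x in \<nu>. RN_deriv \<nu> (ac_part \<mu> \<nu>) x = ennreal (f x) / ennreal (g x)"
    unfolding \<nu>_eq[symmetric] \<mu>_eq[symmetric]
    by (rule RN_deriv_ac_part_density) (auto simp: \<nu>_eq intro: \<nu>.sigma_finite_measure_axioms)
  \<comment> \<open>The set \<open>{g = 0}\<close> carries no mass of the measure with density
    \<open>g\<close>.\<close>
  moreover have "AE x in \<nu>. 0 < g x"
    unfolding \<nu>_eq[symmetric] by (subst AE_density) auto
  moreover have "AE x in \<nu>. \<forall>n. 0 \<le> ?f n x"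
    unfolding AE_all_countable using pos by (intro allI to_\<nu> cond.real_cond_exp_pos) auto
  moreover note to_\<nu>[OF levy_upward[OF gen' int(1)]] to_\<nu>[OF levy_upward[OF gen' int(2)]]
  ultimately show ?thesis
  proof eventually_elim
    case (elim x)
    have "(\<lambda>n. ennreal (?f n x / ?g n x)) \<longlonglongrightarrow> ennreal (f x / g x)"
      using elim(3,5,6) by (intro tendsto_ennrealI tendsto_divide) auto
    \<comment> \<open>Positivity of the denominator, required to convert between real and extended
      quotients, is inherited from the limit only for large \<open>n\<close>.\<close>
    moreover have "\<forall>\<^sub>F n in sequentially. ennreal (?f n x / ?g n x) = ennreal (?f n x) / ennreal (?g n x)"
      using order_tendstoD(1)[OF elim(6,3)] by eventually_elim (use elim(4) in \<open>simp add: divide_ennreal\<close>)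
    ultimately have "(\<lambda>n. ennreal (?f n x) / ennreal (?g n x)) \<longlonglongrightarrow> ennreal (f x / g x)"
      by (rule Lim_transform_eventually)
    then show ?case using elim(1,2,3) pos(1)[of x] by (simp add: divide_ennreal)
  qed
qed

subsection \<open>The double lower limit of Hellinger integrals\<close>

text \<open>Above \<open>K\<close> the negative exponent gives
  \<open>z powr (\<alpha> - 1) \<le> K powr (\<alpha> - 1)\<close>; multiply by \<open>z\<close>.
  For fixed \<open>\<alpha>\<close> this factor tends to 0 as \<open>K\<close> grows, so bounded
  integrals of \<open>z\<close> make the excess uniformly small.\<close>

lemma powr_le_truncated:
  fixes z K \<alpha> :: real
  assumes "0 \<le> z" "0 < K" "0 < \<alpha>" "\<alpha> < 1"
  shows "z powr \<alpha> \<le> min z K powr \<alpha> + K powr (\<alpha> - 1) * z"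
proof (cases "z \<le> K")
  case True
  then show ?thesis using assms by (simp add: min_def)
next
  case False
  then have "z powr (\<alpha> - 1) \<le> K powr (\<alpha> - 1)"
    using assms by (intro powr_mono2') auto
  then have "z powr (\<alpha> - 1) * z \<le> K powr (\<alpha> - 1) * z"
    using assms by (intro mult_right_mono) auto
  moreover have "z powr (\<alpha> - 1) * z = z powr \<alpha>"
    using False assms powr_add[of z "\<alpha> - 1" 1] by simp
  ultimately show ?thesis by (simp add: add_increasing)
qed

text \<open>Truncation at \<open>K = 1\<close> yields a majorant independent of
  \<open>\<alpha>\<close>, as dominated convergence for exponents tending to 1 requires.\<close>

lemma powr_le_one_plus:
  fixes z \<alpha> :: real
  assumes "0 \<le> z" "0 < \<alpha>" "\<alpha> < 1"
  shows "z powr \<alpha> \<le> 1 + z"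
proof -
  have "z powr \<alpha> \<le> min z 1 powr \<alpha> + 1 powr (\<alpha> - 1) * z"
    using assms by (intro powr_le_truncated) auto
  moreover have "min z 1 powr \<alpha> \<le> 1 powr \<alpha>"
    using assms by (intro powr_mono2) auto
  ultimately show ?thesis by simp
qed

text \<open>In the application \<open>N\<close> is \<open>\<nu>\<close>, \<open>r n\<close> and
  \<open>s\<close> are the real versions of the derivatives for the n-th sub-sigma-algebra and for
  the full one, and \<open>C\<close> is the mass of \<open>\<mu>\<close>.\<close>

context
  fixes N :: "'a measure" and r :: "nat \<Rightarrow> 'a \<Rightarrow> real" and s :: "'a \<Rightarrow> real" and C :: real
  assumes finite_N: "finite_measure N"
    and measurable_r[measurable]: "\<And>n. r n \<in> borel_measurable N"
    and measurable_s[measurable]: "s \<in> borel_measurable N"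
    and r_nonneg: "\<And>n x. 0 \<le> r n x" and s_nonneg: "\<And>x. 0 \<le> s x"
    and r_tendsto: "AE x in N. (\<lambda>n. r n x) \<longlonglongrightarrow> s x"
    and r_bound: "\<And>n. (\<integral>\<^sup>+x. ennreal (r n x) \<partial>N) \<le> ennreal C"
begin

interpretation N: finite_measure N by (rule finite_N)

text \<open>Fatou's lemma; the resulting integrability of \<open>s\<close> is needed later to let
  the exponent tend to 1.\<close>

lemma nn_integral_limit_bound: "(\<integral>\<^sup>+x. ennreal (s x) \<partial>N) \<le> ennreal C"
proof -
  have "(\<integral>\<^sup>+x. ennreal (s x) \<partial>N) = (\<integral>\<^sup>+x. liminf (\<lambda>n. ennreal (r n x)) \<partial>N)"
  proof (rule nn_integral_cong_AE)
    show "AE x in N. ennreal (s x) = liminf (\<lambda>n. ennreal (r n x))"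
      using r_tendsto
      by eventually_elim (auto intro!: lim_imp_Liminf[symmetric] tendsto_ennrealI)
  qed
  also have "\<dots> \<le> liminf (\<lambda>n. \<integral>\<^sup>+x. ennreal (r n x) \<partial>N)"
    by (intro nn_integral_liminf) auto
  also have "\<dots> \<le> liminf (\<lambda>n. ennreal C)"
    using r_bound by (intro Liminf_mono) auto
  also have "\<dots> = ennreal C" by (intro lim_imp_Liminf) auto
  finally show ?thesis .
qed

text \<open>If some \<open>c\<close> lay strictly between the double lower limit and the integral,
  every tail rectangle would contain a pair with Hellinger integral below \<open>c\<close>. Along
  such pairs the indices tend to infinity and the exponents to 1, which contradicts Fatou's
  lemma.\<close>

lemma nn_integral_le_liminf_left_1:
  "(\<integral>\<^sup>+x. ennreal (s x) \<partial>N) \<le> liminf_left_1 (\<lambda>\<alpha> n. \<integral>\<^sup>+x. ennreal (r n x powr \<alpha>) \<partial>N)"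
    (is "?I \<le> ?L")
proof (rule ccontr)
  assume "\<not> ?I \<le> ?L"
  then obtain c where c: "?L < c" "c < ?I" using dense[of ?L ?I] by (auto simp: not_le)
  \<comment> \<open>With \<open>k + 2\<close> every \<open>\<beta> k\<close> lies strictly between 0
    and 1; \<open>k + 1\<close> would give \<open>\<beta> 0 = 0\<close>, outside the index set of
    the supremum.\<close>
  define \<beta> where "\<beta> k = 1 - 1 / real (k + 2)" for k :: nat
  have \<beta>: "0 < \<beta> k" "\<beta> k < 1" for k by (auto simp: \<beta>_def field_simps)
  have "\<exists>m a. k \<le> m \<and> \<beta> k \<le> a \<and> a < 1 \<and> (\<integral>\<^sup>+x. ennreal (r m x powr a) \<partial>N) < c" for k
  proof -
    have "(INF (m, a)\<in>{k..} \<times> {\<beta> k..<1}. \<integral>\<^sup>+x. ennreal (r m x powr a) \<partial>N) \<le> ?L"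
      unfolding liminf_left_1_def using \<beta>[of k]
      by (intro SUP_upper2[of "(k, \<beta> k)"]) auto
    then have "(INF (m, a)\<in>{k..} \<times> {\<beta> k..<1}. \<integral>\<^sup>+x. ennreal (r m x powr a) \<partial>N) < c"
      using c(1) by (rule le_less_trans)
    then show ?thesis unfolding INF_less_iff by (auto split: prod.splits) blast
  qed
  then obtain m a where ma: "\<And>k. k \<le> m k" "\<And>k. \<beta> k \<le> a k" "\<And>k. a k < 1"
    "\<And>k. (\<integral>\<^sup>+x. ennreal (r (m k) x powr a k) \<partial>N) < c"
    by metis
  have "\<beta> \<longlonglongrightarrow> 1" unfolding \<beta>_def by real_asymp
  then have a: "a \<longlonglongrightarrow> 1"
    using ma(2,3) by (intro tendsto_sandwich[OF _ _ _ tendsto_const, of \<beta> a]) (auto intro!: always_eventually less_imp_le)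
  have m: "filterlim m sequentially sequentially"
    by (rule filterlim_at_top_mono[OF filterlim_ident]) (use ma(1) in auto)
  have "?I = (\<integral>\<^sup>+x. liminf (\<lambda>k. ennreal (r (m k) x powr a k)) \<partial>N)"
  proof (rule nn_integral_cong_AE)
    show "AE x in N. ennreal (s x) = liminf (\<lambda>k. ennreal (r (m k) x powr a k))"
      using r_tendsto
    proof eventually_elim
      case (elim x)
      \<comment> \<open>Even at a zero of \<open>s\<close> the power converges, because the bases
        are nonnegative and the limit exponent 1 is positive.\<close>
      have "(\<lambda>k. r (m k) x powr a k) \<longlonglongrightarrow> s x powr 1"
        using filterlim_compose[OF elim m] a r_nonneg by (intro tendsto_powr') auto
      then show ?case using s_nonneg[of x] by (intro lim_imp_Liminf[symmetric] tendsto_ennrealI) auto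
    qed
  qed
  also have "\<dots> \<le> liminf (\<lambda>k. \<integral>\<^sup>+x. ennreal (r (m k) x powr a k) \<partial>N)"
    by (intro nn_integral_liminf) auto
  also have "\<dots> \<le> liminf (\<lambda>k::nat. c)"
    using ma(4) by (intro Liminf_mono always_eventually allI less_imp_le)
  also have "\<dots> = c" by (intro lim_imp_Liminf) auto
  finally show False using c(2) by simp
qed

text \<open>Truncate at \<open>K\<close>: the truncated powers converge by bounded convergence on a
  finite measure, and the excess costs at most \<open>K powr (\<alpha> - 1) * C\<close>, which
  vanishes as \<open>K\<close> grows because \<open>\<alpha> < 1\<close>.\<close>

lemma INF_nn_integral_powr_le:
  assumes \<alpha>: "0 < \<alpha>" "\<alpha> < 1"
  shows "(INF m\<in>{n..}. \<integral>\<^sup>+x. ennreal (r m x powr \<alpha>) \<partial>N) \<le> (\<integral>\<^sup>+x. ennreal (s x powr \<alpha>) \<partial>N)"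
    (is "?inf \<le> ?S")
proof -
  have K: "?inf \<le> ?S + ennreal (K powr (\<alpha> - 1)) * ennreal C" if "K > 0" for K
  proof -
    have "(\<lambda>m. \<integral>\<^sup>+x. ennreal (min (r m x) K powr \<alpha>) \<partial>N) \<longlonglongrightarrow> (\<integral>\<^sup>+x. ennreal (min (s x) K powr \<alpha>) \<partial>N)"
    proof (rule nn_integral_dominated_convergence[where w = "\<lambda>_. ennreal (K powr \<alpha>)"])
      show "AE x in N. ennreal (min (r m x) K powr \<alpha>) \<le> ennreal (K powr \<alpha>)" for m
        using \<alpha> \<open>K > 0\<close> r_nonneg by (intro AE_I2 ennreal_leI powr_mono2) auto
      show "(\<integral>\<^sup>+x. ennreal (K powr \<alpha>) \<partial>N) < \<infinity>"
        by (simp add: ennreal_mult_less_top less_top[symmetric] ennreal_mult_eq_top_iff)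
      show "AE x in N. (\<lambda>m. ennreal (min (r m x) K powr \<alpha>)) \<longlonglongrightarrow> ennreal (min (s x) K powr \<alpha>)"
        using r_tendsto
      proof eventually_elim
        case (elim x)
        then show ?case using \<alpha> \<open>K > 0\<close> r_nonneg
          by (intro tendsto_ennrealI tendsto_powr' tendsto_min tendsto_const) auto
      qed
    qed auto
    then have lim: "(\<lambda>m. (\<integral>\<^sup>+x. ennreal (min (r m x) K powr \<alpha>) \<partial>N) + ennreal (K powr (\<alpha> - 1)) * ennreal C)
      \<longlonglongrightarrow> (\<integral>\<^sup>+x. ennreal (min (s x) K powr \<alpha>) \<partial>N) + ennreal (K powr (\<alpha> - 1)) * ennreal C"
      by (intro tendsto_add tendsto_const)
    have "?inf \<le> (\<integral>\<^sup>+x. ennreal (min (r m x) K powr \<alpha>) \<partial>N) + ennreal (K powr (\<alpha> - 1)) * ennreal C"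
      if "n \<le> m" for m
    proof -
      have "?inf \<le> (\<integral>\<^sup>+x. ennreal (r m x powr \<alpha>) \<partial>N)" using that by (intro INF_lower) auto
      also have "\<dots> \<le> (\<integral>\<^sup>+x. ennreal (min (r m x) K powr \<alpha>) + ennreal (K powr (\<alpha> - 1)) * ennreal (r m x) \<partial>N)"
        using powr_le_truncated[OF r_nonneg \<open>K > 0\<close> \<alpha>] r_nonneg
        by (intro nn_integral_mono) (simp flip: ennreal_mult ennreal_plus)
      also have "\<dots> = (\<integral>\<^sup>+x. ennreal (min (r m x) K powr \<alpha>) \<partial>N) + ennreal (K powr (\<alpha> - 1)) * (\<integral>\<^sup>+x. ennreal (r m x) \<partial>N)"
        by (simp add: nn_integral_add nn_integral_cmult)
      also have "\<dots> \<le> (\<integral>\<^sup>+x. ennreal (min (r m x) K powr \<alpha>) \<partial>N) + ennreal (K powr (\<alpha> - 1)) * ennreal C"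
        by (intro add_left_mono mult_left_mono r_bound) simp
      finally show ?thesis .
    qed
    then have "?inf \<le> (\<integral>\<^sup>+x. ennreal (min (s x) K powr \<alpha>) \<partial>N) + ennreal (K powr (\<alpha> - 1)) * ennreal C"
      by (intro LIMSEQ_le_const[OF lim]) auto
    also have "\<dots> \<le> ?S + ennreal (K powr (\<alpha> - 1)) * ennreal C"
      using \<alpha> \<open>K > 0\<close> s_nonneg by (intro add_right_mono nn_integral_mono ennreal_leI powr_mono2) auto
    finally show ?thesis .
  qed
  have "(\<lambda>j. real (Suc j) powr (\<alpha> - 1)) \<longlonglongrightarrow> 0"
    using \<alpha> by real_asymp
  then have "(\<lambda>j. ennreal (real (Suc j) powr (\<alpha> - 1)) * ennreal C) \<longlonglongrightarrow> ennreal 0 * ennreal C"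
    by (intro tendsto_mult_ennreal tendsto_ennrealI tendsto_const) auto
  then have "(\<lambda>j. ?S + ennreal (real (Suc j) powr (\<alpha> - 1)) * ennreal C) \<longlonglongrightarrow> ?S + ennreal 0 * ennreal C"
    by (intro tendsto_add tendsto_const)
  then have "?inf \<le> ?S + ennreal 0 * ennreal C"
    by (rule LIMSEQ_le_const) (use K in auto)
  then show ?thesis by simp
qed

text \<open>The infimum over a rectangle is at most the infimum over \<open>m\<close> at any one
  exponent in it. Hence the index can go to infinity first, with the exponent fixed, and the
  exponent to 1 afterwards, with majorant \<open>1 + s\<close>.\<close>

lemma liminf_left_1_le_nn_integral:
  "liminf_left_1 (\<lambda>\<alpha> n. \<integral>\<^sup>+x. ennreal (r n x powr \<alpha>) \<partial>N) \<le> (\<integral>\<^sup>+x. ennreal (s x) \<partial>N)"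
  unfolding liminf_left_1_def
proof (rule SUP_least, clarify)
  fix n :: nat and \<beta> :: real assume \<beta>: "\<beta> \<in> {0<..<1}"
  let ?inf = "INF (m, a)\<in>{n..} \<times> {\<beta>..<1}. \<integral>\<^sup>+x. ennreal (r m x powr a) \<partial>N"
  define a where "a k = 1 - (1 - \<beta>) / real (k + 2)" for k :: nat
  have a: "\<beta> \<le> a k" "0 < a k" "a k < 1" for k
  proof -
    have "(1 - \<beta>) / real (k + 2) \<le> (1 - \<beta>) / 1" using \<beta> by (intro divide_left_mono) auto
    then show "\<beta> \<le> a k" by (simp add: a_def)
    then show "0 < a k" using \<beta> by simp
    show "a k < 1" using \<beta> by (simp add: a_def)
  qed
  have "a \<longlonglongrightarrow> 1" unfolding a_def by real_asymp
  have "(\<lambda>k. \<integral>\<^sup>+x. ennreal (s x powr a k) \<partial>N) \<longlonglongrightarrow> (\<integral>\<^sup>+x. ennreal (s x) \<partial>N)"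
  proof (rule nn_integral_dominated_convergence[where w = "\<lambda>x. 1 + ennreal (s x)"])
    show "AE x in N. ennreal (s x powr a k) \<le> 1 + ennreal (s x)" for k
      using powr_le_one_plus[OF s_nonneg a(2,3)] s_nonneg
      by (intro AE_I2) (simp flip: ennreal_plus ennreal_1)
    show "(\<integral>\<^sup>+x. 1 + ennreal (s x) \<partial>N) < \<infinity>"
      using le_less_trans[OF nn_integral_limit_bound ennreal_less_top]
      by (simp add: nn_integral_add less_top[symmetric])
    show "AE x in N. (\<lambda>k. ennreal (s x powr a k)) \<longlonglongrightarrow> ennreal (s x)"
    proof (rule AE_I2)
      fix x
      have "(\<lambda>k. s x powr a k) \<longlonglongrightarrow> s x powr 1"
        using \<open>a \<longlonglongrightarrow> 1\<close> s_nonneg by (intro tendsto_powr') auto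
      then show "(\<lambda>k. ennreal (s x powr a k)) \<longlonglongrightarrow> ennreal (s x)"
        using s_nonneg[of x] by (intro tendsto_ennrealI) simp
    qed
  qed auto
  moreover have "?inf \<le> (\<integral>\<^sup>+x. ennreal (s x powr a k) \<partial>N)" for k
  proof -
    have "?inf \<le> (INF m\<in>{n..}. \<integral>\<^sup>+x. ennreal (r m x powr a k) \<partial>N)"
      using a[of k] by (intro INF_greatest) (auto intro: INF_lower2[of "(_, a k)"])
    also have "\<dots> \<le> (\<integral>\<^sup>+x. ennreal (s x powr a k) \<partial>N)" using a by (intro INF_nn_integral_powr_le)
    finally show ?thesis .
  qed
  ultimately show "?inf \<le> (\<integral>\<^sup>+x. ennreal (s x) \<partial>N)"
    by (intro LIMSEQ_le_const) auto
qed

lemma liminf_left_1_powr: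
  "liminf_left_1 (\<lambda>\<alpha> n. \<integral>\<^sup>+x. ennreal (r n x powr \<alpha>) \<partial>N) = (\<integral>\<^sup>+x. ennreal (s x) \<partial>N)"
  using liminf_left_1_le_nn_integral nn_integral_le_liminf_left_1 by (rule antisym)

end

section \<open>Mass and finiteness of the absolutely continuous part\<close>

text \<open>These facts supply the bound \<open>C\<close> and justify replacing the limiting
  derivative by its real version: a finite integral forces finiteness almost everywhere.\<close>

lemma
  assumes S: "sets \<rho> = sets \<sigma>" and \<rho>: "finite_measure \<rho>" and \<sigma>: "finite_measure \<sigma>"
  shows nn_integral_RN_deriv_ac_part:
      "(\<integral>\<^sup>+x. RN_deriv \<sigma> (ac_part \<rho> \<sigma>) x \<partial>\<sigma>) = emeasure (ac_part \<rho> \<sigma>) (space (ac_part \<rho> \<sigma>))"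
    and nn_integral_RN_deriv_ac_part_le:
      "(\<integral>\<^sup>+x. RN_deriv \<sigma> (ac_part \<rho> \<sigma>) x \<partial>\<sigma>) \<le> emeasure \<rho> (space \<rho>)"
    and AE_RN_deriv_ac_part_finite: "AE x in \<sigma>. RN_deriv \<sigma> (ac_part \<rho> \<sigma>) x < \<infinity>"
proof -
  interpret \<rho>: finite_measure \<rho> by fact
  interpret \<sigma>: finite_measure \<sigma> by fact
  obtain \<rho>s where L: "lebesgue_decomposition \<rho> \<sigma> (ac_part \<rho> \<sigma>) \<rho>s"
    using ac_part_lebesgue_decomposition[OF S \<rho>] by blast
  then have ac: "absolutely_continuous \<sigma> (ac_part \<rho> \<sigma>)" "sets (ac_part \<rho> \<sigma>) = sets \<sigma>"
    using S by (auto simp: lebesgue_decomposition_def)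
  have sp: "space (ac_part \<rho> \<sigma>) = space \<sigma>" "space \<rho> = space \<sigma>"
    using ac(2) S by (auto dest: sets_eq_imp_space_eq)
  show eq: "(\<integral>\<^sup>+x. RN_deriv \<sigma> (ac_part \<rho> \<sigma>) x \<partial>\<sigma>) = emeasure (ac_part \<rho> \<sigma>) (space (ac_part \<rho> \<sigma>))"
    using \<sigma>.RN_deriv_nn_integral[OF ac, of "\<lambda>_. 1"] by simp
  have "emeasure \<rho> (space \<rho>) = emeasure (ac_part \<rho> \<sigma>) (space \<rho>) + emeasure \<rho>s (space \<rho>)"
    using L unfolding lebesgue_decomposition_def by blast
  then show le: "(\<integral>\<^sup>+x. RN_deriv \<sigma> (ac_part \<rho> \<sigma>) x \<partial>\<sigma>) \<le> emeasure \<rho> (space \<rho>)"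
    unfolding eq sp by simp
  then have "(\<integral>\<^sup>+x. RN_deriv \<sigma> (ac_part \<rho> \<sigma>) x \<partial>\<sigma>) \<noteq> \<infinity>"
    using \<rho>.emeasure_finite[of "space \<rho>"] by (auto simp: top_unique)
  from nn_integral_PInf_AE[OF _ this] show "AE x in \<sigma>. RN_deriv \<sigma> (ac_part \<rho> \<sigma>) x < \<infinity>"
    by (simp add: less_top)
qed

theorem tv_norm_ac_part_eq_liminf_hellinger:
  fixes G :: "nat \<Rightarrow> 'a measure"
  assumes \<mu>: "finite_measure \<mu>" and \<nu>: "finite_measure \<nu>" and S: "sets \<mu> = sets \<nu>"
    and sub: "\<And>n. subalgebra \<nu> (G n)"
    and mono: "\<And>m n. m \<le> n \<Longrightarrow> sets (G m) \<subseteq> sets (G n)"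
    and gen: "sets \<nu> = sigma_sets (space \<nu>) (\<Union>n. sets (G n))"
  shows "tv_norm (ac_part \<mu> \<nu>) =
    liminf_left_1 (\<lambda>\<alpha> n. hellinger \<alpha> (restr_to_subalg \<mu> (G n)) (restr_to_subalg \<nu> (G n)))"
proof -
  interpret \<mu>: finite_measure \<mu> by fact
  define z where "z n = RN_deriv (restr_to_subalg \<nu> (G n))
    (ac_part (restr_to_subalg \<mu> (G n)) (restr_to_subalg \<nu> (G n)))" for n
  define y where "y = RN_deriv \<nu> (ac_part \<mu> \<nu>)"
  have sub': "subalgebra \<mu> (G n)" for n
    using sub[of n] S sets_eq_imp_space_eq[OF S] by (simp add: subalgebra_def)
  have fin: "finite_measure (restr_to_subalg \<mu> (G n))" "finite_measure (restr_to_subalg \<nu> (G n))"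
    and S': "sets (restr_to_subalg \<mu> (G n)) = sets (restr_to_subalg \<nu> (G n))" for n
    using sub[of n] sub'[of n] \<mu> \<nu> by (simp_all add: finite_measure_restr_to_subalg sets_restr_to_subalg)
  have zG: "z n \<in> borel_measurable (G n)" for n
    unfolding z_def by (rule measurable_in_subalg'[OF sub]) simp
  then have [measurable]: "z n \<in> borel_measurable \<nu>" for n
    by (rule measurable_from_subalg[OF sub])
  have [measurable]: "y \<in> borel_measurable \<nu>" unfolding y_def by simp
  \<comment> \<open>As \<open>z n\<close> is \<open>G n\<close>-measurable, integrating over
    \<open>\<nu>\<close> or over its restriction is the same, so one measure serves for all
    \<open>n\<close>.\<close>
  have H: "hellinger \<alpha> (restr_to_subalg \<mu> (G n)) (restr_to_subalg \<nu> (G n)) =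
    (\<integral>\<^sup>+x. ennreal (enn2real (z n x) powr \<alpha>) \<partial>\<nu>)" for \<alpha> n
    unfolding hellinger_def z_def[symmetric] using zG by (intro nn_integral_subalgebra2 sub) simp
  have y_fin: "AE x in \<nu>. y x < \<infinity>"
    unfolding y_def using S \<mu> \<nu> by (rule AE_RN_deriv_ac_part_finite)
  have "liminf_left_1 (\<lambda>\<alpha> n. \<integral>\<^sup>+x. ennreal (enn2real (z n x) powr \<alpha>) \<partial>\<nu>) = (\<integral>\<^sup>+x. ennreal (enn2real (y x)) \<partial>\<nu>)"
  proof (rule liminf_left_1_powr[OF \<nu>])
    have "AE x in \<nu>. (\<lambda>n. z n x) \<longlonglongrightarrow> y x"
      unfolding z_def y_def by (rule RN_deriv_ac_part_tendsto[OF \<mu> \<nu> S sub _ gen]) (rule mono)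
    then show "AE x in \<nu>. (\<lambda>n. enn2real (z n x)) \<longlonglongrightarrow> enn2real (y x)"
      using y_fin
      by eventually_elim (rule tendsto_enn2real; simp)
    show "(\<integral>\<^sup>+x. ennreal (enn2real (z n x)) \<partial>\<nu>) \<le> ennreal (measure \<mu> (space \<mu>))" for n
    proof -
      \<comment> \<open>\<open>enn2real\<close> sends \<open>\<infinity>\<close> to 0, so the
        inequality holds at every point and no null set has to be discarded.\<close>
      have "(\<integral>\<^sup>+x. ennreal (enn2real (z n x)) \<partial>\<nu>) \<le> (\<integral>\<^sup>+x. z n x \<partial>\<nu>)"
        by (intro nn_integral_mono) (metis ennreal_enn2real_if le_zero_eq order_refl top_greatest)
      also have "\<dots> = (\<integral>\<^sup>+x. z n x \<partial>restr_to_subalg \<nu> (G n))"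
        using zG by (intro nn_integral_subalgebra2[symmetric] sub)
      also have "\<dots> \<le> emeasure (restr_to_subalg \<mu> (G n)) (space (restr_to_subalg \<mu> (G n)))"
        unfolding z_def by (rule nn_integral_RN_deriv_ac_part_le[OF S' fin])
      also have "\<dots> = emeasure \<mu> (space \<mu>)"
        using sub'[of n] sets.top[of "G n"]
        by (simp add: space_restr_to_subalg emeasure_restr_to_subalg subalgebra_def)
      finally show ?thesis by (simp add: \<mu>.emeasure_eq_measure)
    qed
  qed auto
  also have "\<dots> = (\<integral>\<^sup>+x. y x \<partial>\<nu>)"
    using y_fin by (intro nn_integral_cong_AE) (auto elim!: eventually_mono)
  also have "\<dots> = tv_norm (ac_part \<mu> \<nu>)"
    unfolding y_def tv_norm_eq by (rule nn_integral_RN_deriv_ac_part[OF S \<mu> \<nu>])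
  finally show ?thesis by (simp add: H)
qed

subsection \<open>Stopped filtrations\<close>

text \<open>Since \<open>V n\<close> tends to the greatest index \<open>e\<close>, the sets
  \<open>{T < V n}\<close> exhaust \<open>{T < e}\<close>, and on them the minimum is still
  \<open>T\<close>. Only the trace on \<open>{T = e}\<close> has to be recovered from the
  \<open>F t\<close> with \<open>t < e\<close>.\<close>

lemma (in filtration) sets_pre_sigma_min_generate:
  fixes V :: "nat \<Rightarrow> 'a \<Rightarrow> 't"
  assumes T: "stopping_time F T" and V: "\<And>n. stopping_time F (V n)"
    and top: "\<And>s. s \<le> e"
    and gen: "sets (F e) = sigma_sets \<Omega> (\<Union>t\<in>{..<e}. sets (F t))"
    and lim: "\<And>\<omega>. \<omega> \<in> \<Omega> \<Longrightarrow> (\<lambda>n. V n \<omega>) \<longlonglongrightarrow> e"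
  shows "sets (pre_sigma T) = sigma_sets \<Omega> (\<Union>n. sets (pre_sigma (\<lambda>\<omega>. min (T \<omega>) (V n \<omega>))))"
proof
  let ?W = "\<lambda>n \<omega>. min (T \<omega>) (V n \<omega>)"
  have W: "stopping_time F (?W n)" for n using T V by (rule stopping_time_min)
  show "sigma_sets \<Omega> (\<Union>n. sets (pre_sigma (?W n))) \<subseteq> sets (pre_sigma T)"
  proof (rule sets.sigma_sets_subset[of _ "pre_sigma T", unfolded space_pre_sigma])
    show "(\<Union>n. sets (pre_sigma (?W n))) \<subseteq> sets (pre_sigma T)"
      by (rule UN_least, rule mono_pre_sigma[OF W T]) simp
  qed
  \<comment> \<open>\<open>R\<close> packages the generated sigma-algebra as a measure, so that the
    closure rules for \<open>sets\<close> apply.\<close>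
  define R where "R = sigma \<Omega> (\<Union>n. sets (pre_sigma (?W n)))"
  have sub: "(\<Union>n. sets (pre_sigma (?W n))) \<subseteq> Pow \<Omega>"
    by (rule UN_least) (metis sets.space_closed space_pre_sigma)
  have sR: "sets R = sigma_sets \<Omega> (\<Union>n. sets (pre_sigma (?W n)))" and spR: "space R = \<Omega>"
    unfolding R_def using sub by (auto intro: sets_measure_of space_measure_of)
  have R: "A \<in> sets R" if "A \<in> sets (pre_sigma (?W n))" for A n
    unfolding sR using that by (intro sigma_sets.Basic) auto
  have less: "{\<omega>\<in>A. T \<omega> < V n \<omega>} \<in> sets R" if A: "A \<in> sets (pre_sigma T)" for A n
  proof (rule R, rule sets_pre_sigmaI[OF W])
    fix t
    have "{\<omega>\<in>space (pre_sigma T). T \<omega> < V n \<omega>} \<in> sets (pre_sigma T)"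
      using stopping_time_less[OF T V] by (simp add: pred_def)
    then have "A \<inter> {\<omega>\<in>space (pre_sigma T). T \<omega> < V n \<omega>} \<in> sets (pre_sigma T)"
      using A by (rule sets.Int[rotated])
    from sets_pre_sigmaD[OF T this, of t]
    have "{\<omega> \<in> A \<inter> {\<omega>\<in>space (pre_sigma T). T \<omega> < V n \<omega>}. T \<omega> \<le> t} \<in> sets (F t)" .
    also have "{\<omega> \<in> A \<inter> {\<omega>\<in>space (pre_sigma T). T \<omega> < V n \<omega>}. T \<omega> \<le> t} = {\<omega> \<in> {\<omega>\<in>A. T \<omega> < V n \<omega>}. ?W n \<omega> \<le> t}"
      using sets.sets_into_space[OF A] by (auto simp: min_def)
    finally show "{\<omega> \<in> {\<omega>\<in>A. T \<omega> < V n \<omega>}. ?W n \<omega> \<le> t} \<in> sets (F t)" .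
  qed
  have ex: "(\<exists>n. t < V n \<omega>) \<longleftrightarrow> t \<noteq> e" if "\<omega> \<in> \<Omega>" for \<omega> t
  proof
    assume "t \<noteq> e"
    then have "t < e" using top[of t] by simp
    from order_tendstoD(1)[OF lim[OF that] this] show "\<exists>n. t < V n \<omega>"
      by (auto simp: eventually_sequentially)
  qed (use top in \<open>auto simp: not_less[symmetric]\<close>)
  let ?E = "{\<omega>\<in>\<Omega>. T \<omega> = e}"
  have "?E = \<Omega> - (\<Union>n. {\<omega>\<in>\<Omega>. T \<omega> < V n \<omega>})" using ex by auto
  also have "\<dots> \<in> sets R"
    using less[of \<Omega>] sets.top[of R] sets.top[of "pre_sigma T"] unfolding spR space_pre_sigma by auto
  finally have E: "?E \<in> sets R" .
  \<comment> \<open>The induction is relative to \<open>?E\<close>, with complements taken inside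
    it, since only traces on \<open>?E\<close> are needed.\<close>
  have top_part: "A \<inter> ?E \<in> sets R" if "A \<in> sigma_sets \<Omega> (\<Union>t\<in>{..<e}. sets (F t))" for A
    using that
  proof induction
    case (Basic B)
    then obtain t where t: "t < e" "B \<in> sets (F t)" by auto
    then have B: "B \<subseteq> \<Omega>" using sets.sets_into_space[of B "F t"] by (simp add: space_F)
    \<comment> \<open>As \<open>B\<close> is already known at time \<open>t\<close>, its part with
      \<open>t \<le> ?W n\<close> is known at time \<open>?W n\<close>. On \<open>?E\<close> the
      minimum is \<open>V n\<close>, which eventually exceeds \<open>t\<close>, so these parts
      exhaust \<open>B \<inter> ?E\<close>.\<close>
    have "{\<omega>\<in>B. t \<le> ?W n \<omega>} \<in> sets R" for n
    proof (rule R, rule sets_pre_sigmaI[OF W])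
      fix s
      show "{\<omega> \<in> {\<omega>\<in>B. t \<le> ?W n \<omega>}. ?W n \<omega> \<le> s} \<in> sets (F s)"
      proof (cases "t \<le> s")
        case True
        have "{\<omega>\<in>space (F t). ?W n \<omega> < t} \<in> sets (F t)"
          using stopping_time_less_const[OF W] by (simp add: pred_def)
        then have "B - {\<omega>\<in>space (F t). ?W n \<omega> < t} \<in> sets (F s)"
          using t(2) sets_F_mono[OF True] by blast
        moreover have "{\<omega>\<in>space (F s). ?W n \<omega> \<le> s} \<in> sets (F s)"
          using stopping_timeD[OF W] by (simp add: pred_def)
        ultimately have "(B - {\<omega>\<in>space (F t). ?W n \<omega> < t}) \<inter> {\<omega>\<in>space (F s). ?W n \<omega> \<le> s} \<in> sets (F s)"
          by (rule sets.Int)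
        also have "(B - {\<omega>\<in>space (F t). ?W n \<omega> < t}) \<inter> {\<omega>\<in>space (F s). ?W n \<omega> \<le> s} =
          {\<omega> \<in> {\<omega>\<in>B. t \<le> ?W n \<omega>}. ?W n \<omega> \<le> s}"
          using B unfolding space_F by (auto simp only: not_less[symmetric])
        finally show ?thesis .
      next
        case False
        then have "{\<omega> \<in> {\<omega>\<in>B. t \<le> ?W n \<omega>}. ?W n \<omega> \<le> s} = {}" using order_trans by blast
        then show ?thesis by (simp only: sets.empty_sets)
      qed
    qed
    then have "(\<Union>n. {\<omega>\<in>B. t \<le> ?W n \<omega>}) \<inter> ?E \<in> sets R" using E by auto
    also have "(\<Union>n. {\<omega>\<in>B. t \<le> ?W n \<omega>}) \<inter> ?E = B \<inter> ?E"
    proof safe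
      fix \<omega> assume "\<omega> \<in> B" "\<omega> \<in> \<Omega>" "e = T \<omega>"
      moreover obtain n where "t < V n \<omega>" using ex[OF \<open>\<omega> \<in> \<Omega>\<close>, of t] t(1) by auto
      ultimately show "\<omega> \<in> (\<Union>n. {\<omega>\<in>B. t \<le> ?W n \<omega>})"
        using t(1) by (intro UN_I[of n]) auto
    qed
    finally show ?case .
  next
    case Empty
    show ?case by simp
  next
    case (Compl A)
    have "(\<Omega> - A) \<inter> ?E = ?E - A \<inter> ?E" by auto
    then show ?case using Compl.IH E by auto
  next
    case (Union A)
    have "(\<Union>i. A i \<inter> ?E) \<in> sets R" using Union.IH by blast
    also have "(\<Union>i. A i \<inter> ?E) = (\<Union>i. A i) \<inter> ?E" by blast
    finally show ?case .
  qed
  show "sets (pre_sigma T) \<subseteq> sigma_sets \<Omega> (\<Union>n. sets (pre_sigma (?W n)))"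
    unfolding sR[symmetric]
  proof
    fix A assume A: "A \<in> sets (pre_sigma T)"
    then have A\<Omega>: "A \<subseteq> \<Omega>" using sets.sets_into_space[OF A] by (simp add: space_pre_sigma)
    have "A \<in> sets (F e)" using sets_pre_sigmaD[OF T A, of e] top by simp
    then have "A \<inter> ?E \<in> sets R" using top_part gen by simp
    then have "(\<Union>n. {\<omega>\<in>A. T \<omega> < V n \<omega>}) \<union> A \<inter> ?E \<in> sets R" using less[OF A] by auto
    also have "(\<Union>n. {\<omega>\<in>A. T \<omega> < V n \<omega>}) \<union> A \<inter> ?E = A" using ex A\<Omega> by blast
    finally show "A \<in> sets R" .
  qed
qed

section \<open>Transfer to the restrictions at stopping times\<close>

text \<open>Values of \<open>T\<close> never exceed \<open>e\<close>, so the membership condition of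
  the stopped sigma-algebra at time \<open>e\<close> reads as membership in
  \<open>F e\<close>.\<close>

lemma (in filtration) subalgebra_pre_sigma:
  assumes "stopping_time F T" and "sets M = sets (F e)" and "\<And>s. s \<le> e"
  shows "subalgebra M (pre_sigma T)"
  unfolding subalgebra_def
proof
  show "space (pre_sigma T) = space M"
    using sets_eq_imp_space_eq[OF assms(2)] by (simp add: space_pre_sigma space_F)
  show "sets (pre_sigma T) \<subseteq> sets M"
    using sets_pre_sigmaD[OF assms(1), of _ e] assms(2,3) by auto
qed

lemma restr_to_subalg_restr_to_subalg:
  assumes "subalgebra M F" "subalgebra F G"
  shows "restr_to_subalg (restr_to_subalg M F) G = restr_to_subalg M G"
proof -
  have MG: "subalgebra M G" and RG: "subalgebra (restr_to_subalg M F) G"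
    using assms by (auto simp: subalgebra_def sets_restr_to_subalg space_restr_to_subalg)
  show ?thesis
    using MG RG assms
    by (intro measure_eqI) (auto simp: sets_restr_to_subalg emeasure_restr_to_subalg subalgebra_def)
qed

theorem corollary2:
  fixes \<Omega> :: "'a set" and F :: "ennreal \<Rightarrow> 'a measure" and \<mu> \<nu> :: "'a measure"
    and V :: "nat \<Rightarrow> 'a \<Rightarrow> ennreal" and T :: "'a \<Rightarrow> ennreal"
  assumes "filtration \<Omega> F"
    and "right_continuous_filtration F"
    and "sets (F \<infinity>) = sigma_sets \<Omega> (\<Union>t\<in>{..<\<infinity>}. sets (F t))"
    and "prob_space \<mu>" and "sets \<mu> = sets (F \<infinity>)"
    and "prob_space \<nu>" and "sets \<nu> = sets (F \<infinity>)"
    and "\<And>n. stopping_time F (V n)"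
    and "\<And>\<omega>. \<omega> \<in> \<Omega> \<Longrightarrow> incseq (\<lambda>n. V n \<omega>)"
    and "\<And>\<omega>. \<omega> \<in> \<Omega> \<Longrightarrow> (\<lambda>n. V n \<omega>) \<longlonglongrightarrow> \<infinity>"
    and "stopping_time F T"
  shows "tv_norm (ac_part (restr_stop \<Omega> F \<mu> T) (restr_stop \<Omega> F \<nu> T)) =
      liminf_left_1 (\<lambda>\<alpha> n. hellinger \<alpha>
        (restr_stop \<Omega> F \<mu> (\<lambda>\<omega>. min (T \<omega>) (V n \<omega>)))
        (restr_stop \<Omega> F \<nu> (\<lambda>\<omega>. min (T \<omega>) (V n \<omega>))))
    \<and> (AE \<omega> in restr_stop \<Omega> F \<nu> T.
        (\<lambda>n. RN_deriv (restr_stop \<Omega> F \<nu> (\<lambda>\<omega>. min (T \<omega>) (V n \<omega>)))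
              (ac_part (restr_stop \<Omega> F \<mu> (\<lambda>\<omega>. min (T \<omega>) (V n \<omega>)))
                       (restr_stop \<Omega> F \<nu> (\<lambda>\<omega>. min (T \<omega>) (V n \<omega>)))) \<omega>)
        \<longlonglongrightarrow> RN_deriv (restr_stop \<Omega> F \<nu> T)
              (ac_part (restr_stop \<Omega> F \<mu> T) (restr_stop \<Omega> F \<nu> T)) \<omega>)"
proof -
  interpret filtration \<Omega> F by fact
  let ?W = "\<lambda>n \<omega>. min (T \<omega>) (V n \<omega>)"
  define G where "G n = pre_sigma (?W n)" for n
  have W: "stopping_time F (?W n)" for n using assms(11,8) by (rule stopping_time_min)
  have top: "s \<le> \<infinity>" for s :: ennreal by simp
  note subT = subalgebra_pre_sigma[OF assms(11) _ top]
  have subG: "subalgebra (pre_sigma T) (G n)" for n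
    using mono_pre_sigma[OF W assms(11), of n] by (simp add: G_def subalgebra_def space_pre_sigma)
  \<comment> \<open>The restrictions at \<open>T\<close> become the base pair of measures and those
    at the minima become further restrictions of them, the form in which the two abstract theorems
    apply.\<close>
  define \<mu>T \<nu>T where "\<mu>T = restr_to_subalg \<mu> (pre_sigma T)" and "\<nu>T = restr_to_subalg \<nu> (pre_sigma T)"
  have stop: "restr_stop \<Omega> F \<mu> T = \<mu>T" "restr_stop \<Omega> F \<nu> T = \<nu>T"
    "restr_stop \<Omega> F \<mu> (?W n) = restr_to_subalg \<mu>T (G n)"
    "restr_stop \<Omega> F \<nu> (?W n) = restr_to_subalg \<nu>T (G n)" for n
    unfolding restr_stop_def \<mu>T_def \<nu>T_def
    by (simp_all add: restr_to_subalg_restr_to_subalg[OF subT[OF assms(5)] subG]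
        restr_to_subalg_restr_to_subalg[OF subT[OF assms(7)] subG], simp_all add: G_def)
  have fin: "finite_measure \<mu>T" "finite_measure \<nu>T"
    unfolding \<mu>T_def \<nu>T_def using subT[OF assms(5)] subT[OF assms(7)]
      prob_space.finite_measure[OF assms(4)] prob_space.finite_measure[OF assms(6)]
    by (simp_all add: finite_measure_restr_to_subalg)
  have sets_T: "sets \<mu>T = sets (pre_sigma T)" "sets \<nu>T = sets (pre_sigma T)"
    unfolding \<mu>T_def \<nu>T_def using subT assms(5,7) by (simp_all add: sets_restr_to_subalg)
  then have S: "sets \<mu>T = sets \<nu>T" by simp
  have sp: "space \<nu>T = \<Omega>" using sets_eq_imp_space_eq[OF sets_T(2)] by (simp add: space_pre_sigma)
  have sub: "subalgebra \<nu>T (G n)" for n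
    using subG[of n] sets_T(2) sp by (simp add: subalgebra_def space_pre_sigma)
  have mono: "sets (G m) \<subseteq> sets (G n)" if "m \<le> n" for m n
    unfolding G_def using that assms(9) by (intro mono_pre_sigma W) (auto simp: incseq_def min.coboundedI2 intro: min.mono)
  have gen: "sets \<nu>T = sigma_sets (space \<nu>T) (\<Union>n. sets (G n))"
    unfolding sp sets_T G_def
    by (rule sets_pre_sigma_min_generate[OF assms(11,8) top assms(3,10)])
  show ?thesis
    unfolding stop
    by (intro conjI tv_norm_ac_part_eq_liminf_hellinger[OF fin S sub _ gen]
        RN_deriv_ac_part_tendsto[OF fin S sub _ gen] mono)
qed

end
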